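(* Let $r_M>0$ and let $r:(0,\infty)\times[0,r_M]\to\mathbb{R}$ satisfy $0\le r(x,I)\le r_M$ for all $x>0$, $I\in[0,r_M]$, $\frac{\partial r}{\partial I}\in L^\infty((0,\infty)\times(0,r_M))$, $\frac{\partial r}{\partial I}\le 0$, and $r(x,I)\ge r_0$ for some constant $r_0>0$. Let $n_{\rm ini}\in L^1(0,\infty)$, $n_{\rm ini}\ge0$, $\int_0^\infty n_{\rm ini}=1$. Let $\Phi(I)=\big(\int_0^\infty e^{-R(x,I)}dx\big)^{-1}$ with $R(x,I)=\int_0^x r(y,I)\,dy$, let $\overline I$ be the unique fixed point of $\Phi$ in $[0,r_M]$, and assume that $\Phi$ is differentiable at $\overline I$ with $\Phi'(\overline I)<-1$. Then there exist $I_-<\overline I<I_+$ in $[0,r_M]$ with $\Phi(I_-)=I_+$ and $\Phi(I_+)=I_-$ such that the following holds for $I_{\rm ini}=I_-$ and for $I_{\rm ini}=I_+$. For $d>0$, let $\overline n_d(t,x)$ be the $2d$-periodic function of $t\geq 0$ equal to $\overline n(x,I_{\rm ini})$ for $0\le t<d$ and to $\overline n(x,\Phi(I_{\rm ini}))$ for $d\le t<2d$, where $\overline n(x,I)=\Phi(I)e^{-R(x,I)}$. Let $n_d$ be the solution of the delayed equation $$\begin{cases}\partial_t n(t,x)+\partial_x n(t,x)+r(x,I(t-d))\,n(t,x)=0, & t,x\ge0,\\ I(t)=\int_0^\infty r(x,I(t-d))\,n(t,x)\,dx, & t\geq 0,\\ n(t,x=0)=I(t),\\ n(t=0)=n_{\rm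 ini},\\ I(t)=I_{\rm ini}, & t\in[-d,0).\end{cases}$$ Then for all $A>0$, $$\frac1d\int_0^{Ad}\|n_d(t,\cdot)-\overline n_d(t,\cdot)\|_1\,dt\longrightarrow 0\quad\text{as } d\to\infty.$$
   Context: Notation: $\|u\|_1=\int_0^\infty|u(x)|\,dx$. A solution of the delayed equation is $n\in C([0,\infty);L^1(0,\infty))$ with $n\ge0$, $\int_0^\infty n(t,x)dx=1$, together with a measurable activity $I:[-d,\infty)\to[0,r_M]$; the transport equation is understood in the weak sense (by characteristics): $n(t,x)=n_{\rm ini}(x-t)\exp(-\int_0^t r(x-t+s,I(s-d))ds)$ for $x\ge t$ and $n(t,x)=I(t-x)\exp(-\int_0^x r(s,I(t-x+s-d))ds)$ for $x<t$. Under the assumptions $\Phi:[0,r_M]\to[0,r_M]$ is continuous and non-increasing, hence has a unique fixed point. *)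

theory Defs
  imports "HOL-Analysis.Analysis" "HOL-Library.Real_Mod"
begin

text \<open>
  Elements of \<open>L\<^sup>1(0,\<infinity>)\<close> are represented by functions on the reals that are absolutely
  integrable over \<open>{0<..}\<close>; their values outside \<open>{0<..}\<close> and on null sets are irrelevant.
  All integrals are with respect to the completed Lebesgue measure.
\<close>

definition L1_norm :: "(real \<Rightarrow> real) \<Rightarrow> real" where
  "L1_norm u = (LINT x:{0<..}|lebesgue. \<bar>u x\<bar>)"

definition prob_density :: "(real \<Rightarrow> real) \<Rightarrow> bool" where
  "prob_density u \<longleftrightarrow>
     set_integrable lebesgue {0<..} u \<and>
     (AE x in lebesgue. 0 < x \<longrightarrow> 0 \<le> u x) \<and>
     (LINT x:{0<..}|lebesgue. u x) = 1"

text \<open>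
  \<open>has_partial_I r\<^sub>M r g\<close>: the function \<open>g\<close> is the partial derivative \<open>\<partial>r/\<partial>I\<close> on
  \<open>(0,\<infinity>) \<times> (0,r\<^sub>M)\<close>. As \<open>\<partial>r/\<partial>I\<close> is an \<open>L\<^sup>\<infinity>\<close> function it is only given almost everywhere, and
  it is understood in the weak sense: for almost every \<open>x\<close> the section \<open>r(x,\<cdot>)\<close> is absolutely
  continuous on \<open>[0,r\<^sub>M]\<close> with derivative \<open>g(x,\<cdot>)\<close>. This includes classical derivatives that
  exist everywhere and are essentially bounded (with \<open>r(x,\<cdot>)\<close> continuous up to the end points),
  and it excludes singular sections (Cantor functions), whose derivative vanishes almost
  everywhere although they are not constant.
\<close>

definition has_partial_I ::
  "real \<Rightarrow> (real \<Rightarrow> real \<Rightarrow> real) \<Rightarrow> (real \<Rightarrow> real \<Rightarrow> real) \<Rightarrow> bool" where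
  "has_partial_I r\<^sub>M r g \<longleftrightarrow>
     (\<lambda>(x, J). g x J) \<in> borel_measurable (lebesgue_on ({0<..} \<times> {0<..<r\<^sub>M})) \<and>
     (AE x in lebesgue. 0 < x \<longrightarrow>
        (\<forall>a b. 0 \<le> a \<and> a \<le> b \<and> b \<le> r\<^sub>M \<longrightarrow>
           set_integrable lebesgue {a<..<b} (g x) \<and>
           r x b - r x a = (LINT J:{a<..<b}|lebesgue. g x J)))"

definition firing_R :: "(real \<Rightarrow> real \<Rightarrow> real) \<Rightarrow> real \<Rightarrow> real \<Rightarrow> real" where
  "firing_R r x J = (LINT y:{0<..x}|lebesgue. r y J)"

definition Phi :: "(real \<Rightarrow> real \<Rightarrow> real) \<Rightarrow> real \<Rightarrow> real" where
  "Phi r J = inverse (LINT x:{0<..}|lebesgue. exp (- firing_R r x J))"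

definition nbar :: "(real \<Rightarrow> real \<Rightarrow> real) \<Rightarrow> real \<Rightarrow> real \<Rightarrow> real" where
  "nbar r x J = Phi r J * exp (- firing_R r x J)"

definition nbar_per :: "(real \<Rightarrow> real \<Rightarrow> real) \<Rightarrow> real \<Rightarrow> real \<Rightarrow> real \<Rightarrow> real \<Rightarrow> real" where
  "nbar_per r I\<^sub>i\<^sub>n\<^sub>i d t x =
     (if t rmod (2 * d) < d then nbar r x I\<^sub>i\<^sub>n\<^sub>i else nbar r x (Phi r I\<^sub>i\<^sub>n\<^sub>i))"

text \<open>
  \<open>delayed_solution r\<^sub>M r n\<^sub>i\<^sub>n\<^sub>i I\<^sub>i\<^sub>n\<^sub>i d n I\<close>: the pair \<open>(n, I)\<close> solves the equation with delay \<open>d\<close>.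
  The transport equation and the boundary condition \<open>n(t,0) = I(t)\<close> are encoded together by the
  representation along characteristics, which is an identity in \<open>L\<^sup>1(0,\<infinity>)\<close> for every \<open>t \<ge> 0\<close>.
\<close>

definition delayed_solution ::
  "real \<Rightarrow> (real \<Rightarrow> real \<Rightarrow> real) \<Rightarrow> (real \<Rightarrow> real) \<Rightarrow> real \<Rightarrow> real \<Rightarrow>
   (real \<Rightarrow> real \<Rightarrow> real) \<Rightarrow> (real \<Rightarrow> real) \<Rightarrow> bool" where
  "delayed_solution r\<^sub>M r n\<^sub>i\<^sub>n\<^sub>i I\<^sub>i\<^sub>n\<^sub>i d n I \<longleftrightarrow>
     I \<in> borel_measurable (lebesgue_on {-d..}) \<and>
     (\<forall>t\<ge>-d. I t \<in> {0..r\<^sub>M}) \<and>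
     (\<forall>t\<in>{-d..<0}. I t = I\<^sub>i\<^sub>n\<^sub>i) \<and>
     (\<forall>t\<ge>0. prob_density (n t)) \<and>
     (\<forall>t\<ge>0. ((\<lambda>s. L1_norm (\<lambda>x. n s x - n t x)) \<longlongrightarrow> 0) (at t within {0..})) \<and>
     (AE x in lebesgue. 0 < x \<longrightarrow> n 0 x = n\<^sub>i\<^sub>n\<^sub>i x) \<and>
     (\<forall>t\<ge>0. AE x in lebesgue. 0 < x \<longrightarrow>
        n t x =
          (if t \<le> x
           then n\<^sub>i\<^sub>n\<^sub>i (x - t) * exp (- (LINT s:{0..t}|lebesgue. r (x - t + s) (I (s - d))))
           else I (t - x) * exp (- (LINT s:{0..x}|lebesgue. r s (I (t - x + s - d)))))) \<and>
     (\<forall>t\<ge>0. I t = (LINT x:{0<..}|lebesgue. r x (I (t - d)) * n t x))"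

end

theory Submission
  imports Defs
begin

text \<open>
  On each interval \<open>[k d, (k + 1) d)\<close> the delayed activity \<open>I(t - d)\<close> acts as a prescribed input. If this
  input were a constant \<open>J\<close>, the equation would be a linear renewal equation whose solution relaxes to the
  stationary profile \<open>nbar(\<cdot>, J)\<close>, with activity \<open>Phi J\<close>, after a transient whose length depends neither
  on \<open>d\<close> nor on the data at time \<open>k d\<close>. Starting from the constant history \<open>I\<^sub>i\<^sub>n\<^sub>i\<close>, the activity is therefore
  close to \<open>Phi I\<^sub>i\<^sub>n\<^sub>i\<close> on the first interval after a transient, hence close to \<open>Phi (Phi I\<^sub>i\<^sub>n\<^sub>i)\<close> on the second one, and so
  on; the input is not exactly constant from the second interval on, but relaxation is stable under small
  perturbations of the input. Only finitely many intervals meet \<open>[0, A d]\<close>, so the transients have a total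
  length that stays bounded as \<open>d\<close> grows, and division by \<open>d\<close> makes their contribution vanish. Errors may
  grow from one interval to the next, but only over boundedly many of them.

  The heart is the relaxation estimate. Write \<open>u = n(t, \<cdot>) - nbar(\<cdot>, J)\<close> and \<open>S = exp (- R(\<cdot>, J))\<close>. Because
  \<open>u\<close> has integral zero, a multiple \<open>r\<^sub>0\<close> of it can be subtracted from the rate, and
  \<open>I t - Phi J\<close> equals \<open>\<integral> (r(x, J) - r\<^sub>0) u dx\<close> up to the input error (\<open>activity_deviation_le\<close>). By the
  representation along characteristics, \<open>u\<close> at age \<open>x\<close> is bounded by the activity error at time \<open>t - x\<close> times
  \<open>S x\<close>, up to a remainder of small integral (\<open>near_stationary_majorant\<close>). Since
  \<open>\<integral> r(x, J) S dx = 1\<close> (\<open>survival_balance\<close>) and \<open>\<integral> S dx \<ge> 1 / r\<^sub>M\<close>, the weight \<open>(r(x, J) - r\<^sub>0) S\<close> has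
  integral at most \<open>1 - r\<^sub>0 / r\<^sub>M < 1\<close>. A bound on the activity error over a window of length \<open>L\<close> thus
  improves by this factor after the window has elapsed, up to a small additive term
  (\<open>activity_contraction\<close>), and iteration gives the relaxation (\<open>relaxation\<close>).

  The two-cycle itself comes from the intermediate value theorem: \<open>Phi \<circ> Phi\<close> maps \<open>[0, r\<^sub>M]\<close> into itself
  and has slope \<open>\<Phi>'\<^sup>2 > 1\<close> at \<open>Ibar\<close>, so it has a fixed point to the left of \<open>Ibar\<close>
  (\<open>antitone_two_cycle\<close>).
\<close>

section \<open>Integration on rays and intervals\<close>

lemma
  fixes a c :: real
  assumes "0 < a"
  shows exp_decay_integrable: "set_integrable lebesgue {c..} (\<lambda>x. exp (- (a * x)))"
    and exp_decay_integral: "(LINT x:{c..}|lebesgue. exp (- (a * x))) = exp (- (a * c)) / a"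
proof -
  show int: "set_integrable lebesgue {c..} (\<lambda>x. exp (- (a * x)))"
    using integrable_on_exp_minus_to_infinity[OF assms, of c]
    by (intro nonnegative_absolutely_integrable_1) auto
  show "(LINT x:{c..}|lebesgue. exp (- (a * x))) = exp (- (a * c)) / a"
    using has_integral_exp_minus_to_infinity[OF assms, of c] set_lebesgue_integral_eq_integral[OF int]
    by (simp add: integral_unique)
qed

lemma set_integral_open_closed_ray:
  fixes f :: "real \<Rightarrow> real"
  shows "(LINT x:{c<..}|lebesgue. f x) = (LINT x:{c..}|lebesgue. f x)"
    and "set_integrable lebesgue {c<..} f \<longleftrightarrow> set_integrable lebesgue {c..} f"
proof -
  show "(LINT x:{c<..}|lebesgue. f x) = (LINT x:{c..}|lebesgue. f x)"
    by (rule set_integral_discrete_difference[where X = "{c}"]) auto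
  show "set_integrable lebesgue {c<..} f \<longleftrightarrow> set_integrable lebesgue {c..} f"
    by (rule set_integrable_discrete_difference[where X = "{c}"]) auto
qed

text \<open>
  Such a function has derivative zero everywhere. This replaces the fundamental theorem of calculus for
  absolutely continuous functions in the balance law for the survival function, where the
  derivatives exist only almost everywhere.
\<close>

lemma constant_if_quadratic_increments:
  fixes F :: "real \<Rightarrow> real"
  assumes incr: "\<And>x y. 0 \<le> x \<Longrightarrow> x \<le> y \<Longrightarrow> \<bar>F y - F x\<bar> \<le> K * (y - x)\<^sup>2" and "0 \<le> x"
  shows "F x = F 0"
proof -
  have "(F has_real_derivative 0) (at y within {0..})" if "y \<in> {0..}" for y
    unfolding has_field_derivative_iff
  proof (rule Lim_null_comparison)
    show "\<forall>\<^sub>F z in at y within {0..}. norm ((F z - F y) / (z - y)) \<le> \<bar>K\<bar> * \<bar>z - y\<bar>"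
    proof (rule eventually_at_topological[THEN iffD2], intro exI[of _ UNIV] conjI ballI impI)
      fix z assume z: "z \<noteq> y" "z \<in> {0..}"
      have "\<bar>F z - F y\<bar> \<le> K * (z - y)\<^sup>2"
        using incr[of y z] incr[of z y] that z by (cases "y \<le> z") (auto simp: abs_minus_commute power2_commute)
      also have "\<dots> \<le> \<bar>K\<bar> * (z - y)\<^sup>2"
        by (intro mult_right_mono) auto
      finally have "\<bar>F z - F y\<bar> \<le> \<bar>K\<bar> * (\<bar>z - y\<bar> * \<bar>z - y\<bar>)"
        by (simp add: power2_eq_square)
      then show "norm ((F z - F y) / (z - y)) \<le> \<bar>K\<bar> * \<bar>z - y\<bar>"
        using z by (simp add: divide_simps mult.assoc)
    qed auto
    have "((\<lambda>z. \<bar>K\<bar> * \<bar>z - y\<bar>) \<longlongrightarrow> \<bar>K\<bar> * \<bar>y - y\<bar>) (at y within {0..})"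
      by (intro tendsto_intros)
    then show "((\<lambda>z. \<bar>K\<bar> * \<bar>z - y\<bar>) \<longlongrightarrow> 0) (at y within {0..})" by simp
  qed
  then obtain c where "\<And>y. y \<in> {0..} \<Longrightarrow> F y = c"
    using has_field_derivative_zero_constant[of "{0::real..}" F] by auto
  then show ?thesis using assms(2) by auto
qed

lemma set_integrable_dominated:
  fixes f g :: "real \<Rightarrow> real"
  assumes "f \<in> borel_measurable (lebesgue_on A)" and "A \<in> sets lebesgue"
    and "set_integrable lebesgue A g" and "AE x in lebesgue. x \<in> A \<longrightarrow> \<bar>f x\<bar> \<le> g x"
  shows "set_integrable lebesgue A f"
proof (rule set_integrable_bound[OF assms(3)])
  show "set_borel_measurable lebesgue A f"
    using assms(1,2) by (simp add: set_borel_measurable_def borel_measurable_restrict_space_iff)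
  show "AE x in lebesgue. x \<in> A \<longrightarrow> norm (f x) \<le> norm (g x)"
    using assms(4) by eventually_elim force
qed

lemma set_integral_half_open_closed:
  fixes f :: "real \<Rightarrow> real"
  shows "(LINT x:{a<..b}|lebesgue. f x) = (LINT x:{a..b}|lebesgue. f x)"
    and "set_integrable lebesgue {a<..b} f \<longleftrightarrow> set_integrable lebesgue {a..b} f"
proof -
  show "(LINT x:{a<..b}|lebesgue. f x) = (LINT x:{a..b}|lebesgue. f x)"
    by (rule set_integral_discrete_difference[where X = "{a}"]) auto
  show "set_integrable lebesgue {a<..b} f \<longleftrightarrow> set_integrable lebesgue {a..b} f"
    by (rule set_integrable_discrete_difference[where X = "{a}"]) auto
qed

lemma set_integrable_const_Icc: "set_integrable lebesgue {a..b} (\<lambda>_. c)" for a b c :: real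
  unfolding set_integrable_def
  by (cases "a \<le> b") (auto intro!: integrable_scaleR_left)

lemma set_integral_const_Icc: "a \<le> b \<Longrightarrow> (LINT x:{a..b}|lebesgue. c) = c * (b - a)" for a b c :: real
  by (simp add: set_integral_const)

lemma set_integral_bounds_Icc:
  fixes f :: "real \<Rightarrow> real"
  assumes "set_integrable lebesgue {a..b} f" and "a \<le> b"
    and "AE s in lebesgue. a < s \<and> s \<le> b \<longrightarrow> l \<le> f s \<and> f s \<le> u"
  shows "l * (b - a) \<le> (LINT s:{a..b}|lebesgue. f s) \<and> (LINT s:{a..b}|lebesgue. f s) \<le> u * (b - a)"
proof -
  have "AE s in lebesgue. s \<noteq> a"
    by (simp add: AE_completion_iff AE_lborel_singleton)
  with assms(3) have "AE s \<in> {a..b} in lebesgue. l \<le> f s" "AE s \<in> {a..b} in lebesgue. f s \<le> u"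
    by (eventually_elim; force)+
  from set_integral_mono_AE[OF set_integrable_const_Icc assms(1) this(1)]
    set_integral_mono_AE[OF assms(1) set_integrable_const_Icc this(2)]
  show ?thesis
    using assms(2) by (simp add: set_integral_const_Icc)
qed

lemma AE_lebesgue_shift:
  fixes P :: "real \<Rightarrow> bool"
  assumes "AE x in lebesgue. P x"
  shows "AE x in lebesgue. P (c + x)"
proof -
  have eq: "lebesgue = distr lebesgue lebesgue (\<lambda>x. c + x)"
    using lebesgue_real_affine[of 1 c] by (simp add: density_1)
  have "AE x in distr lebesgue lebesgue (\<lambda>x. c + x). P x"
    unfolding eq[symmetric] by (rule assms)
  moreover have "(\<lambda>x. c + x) \<in> lebesgue \<rightarrow>\<^sub>M lebesgue"
    using lebesgue_affine_measurable[where c = "\<lambda>x::real. 1" and t = c] by simp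
  ultimately show ?thesis
    by (rule AE_distrD[rotated])
qed

lemma abs_exp_neg_diff_le:
  fixes a b :: real
  assumes "0 \<le> a" "0 \<le> b"
  shows "\<bar>exp (- a) - exp (- b)\<bar> \<le> \<bar>a - b\<bar>"
proof -
  have *: "exp (- x) - exp (- y) \<le> y - x" if "0 \<le> x" "x \<le> y" for x y :: real
  proof -
    have "exp (- x) - exp (- y) = exp (- x) * (1 - exp (- (y - x)))"
      by (simp add: algebra_simps flip: exp_add)
    also have "\<dots> \<le> 1 * (1 - exp (- (y - x)))"
      using that by (intro mult_right_mono) auto
    also have "\<dots> \<le> y - x"
      using exp_ge_add_one_self[of "- (y - x)"] unfolding mult_1 by linarith
    finally show ?thesis .
  qed
  show ?thesis
    using *[of a b] *[of b a] assms by (cases "a \<le> b") (auto simp: abs_if)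
qed

text \<open>
  If the smaller function is not integrable, its integral is \<open>0\<close> by convention and the comparison still
  holds. The smaller function will be the distance to the periodic profile, as a function of time.
\<close>

lemma set_integral_le_nonneg:
  fixes f g :: "real \<Rightarrow> real"
  assumes "\<And>x. x \<in> A \<Longrightarrow> 0 \<le> f x" "\<And>x. x \<in> A \<Longrightarrow> f x \<le> g x" "set_integrable M A g"
  shows "0 \<le> (LINT x:A|M. f x)" "(LINT x:A|M. f x) \<le> (LINT x:A|M. g x)"
proof -
  show nonneg: "0 \<le> (LINT x:A|M. f x)"
    using assms(1) unfolding set_lebesgue_integral_def
    by (intro integral_nonneg_AE AE_I2) (auto simp: indicator_def)
  show "(LINT x:A|M. f x) \<le> (LINT x:A|M. g x)"
  proof (cases "set_integrable M A f")
    case True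
    then show ?thesis using assms by (intro set_integral_mono) auto
  next
    case False
    then have "(LINT x:A|M. f x) = 0"
      by (simp add: set_integrable_def set_lebesgue_integral_def not_integrable_integral_eq)
    also have "0 \<le> (LINT x:A|M. g x)"
      unfolding set_lebesgue_integral_def
      by (intro integral_nonneg_AE AE_I2) (use assms(1,2) in \<open>force simp: indicator_def\<close>)
    finally show ?thesis .
  qed
qed

lemma bounded_mult_integrable:
  fixes w g :: "real \<Rightarrow> real"
  assumes g: "set_integrable lebesgue A g" and w: "w \<in> borel_measurable (lebesgue_on A)"
    and A: "A \<in> sets lebesgue" and bound: "\<And>x. x \<in> A \<Longrightarrow> \<bar>w x\<bar> \<le> B"
  shows "set_integrable lebesgue A (\<lambda>x. w x * g x)"
proof (rule set_integrable_dominated[OF _ A])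
  show "(\<lambda>x. w x * g x) \<in> borel_measurable (lebesgue_on A)"
    by (intro borel_measurable_times w absolutely_integrable_imp_borel_measurable[OF g A])
  show "set_integrable lebesgue A (\<lambda>x. B * \<bar>g x\<bar>)"
    using set_integrable_abs[OF g] by simp
  show "AE x in lebesgue. x \<in> A \<longrightarrow> \<bar>w x * g x\<bar> \<le> B * \<bar>g x\<bar>"
    by (intro AE_I2 impI) (use bound in \<open>auto simp: abs_mult intro: mult_right_mono\<close>)
qed

lemma abs_set_integral_le:
  fixes f g :: "real \<Rightarrow> real"
  assumes f: "set_integrable lebesgue A f" and g: "set_integrable lebesgue A g"
    and le: "AE x \<in> A in lebesgue. \<bar>f x\<bar> \<le> g x"
  shows "\<bar>LINT x:A|lebesgue. f x\<bar> \<le> (LINT x:A|lebesgue. g x)"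
proof -
  have "\<bar>LINT x:A|lebesgue. f x\<bar> \<le> (LINT x:A|lebesgue. \<bar>f x\<bar>)"
    using set_integral_norm_bound[OF f] by simp
  also have "\<dots> \<le> (LINT x:A|lebesgue. g x)"
    by (intro set_integral_mono_AE set_integrable_abs f g le)
  finally show ?thesis .
qed

section \<open>Regularity of the firing rate\<close>

text \<open>
  Superposition with a Caratheodory function: \<open>G\<close> is a limit of functions with countably many values, for
  which the superposition is a countable patchwork of measurable sections, and continuity of \<open>f s\<close> passes
  to the limit. The rate \<open>r\<close> is only measurable in age for each fixed activity, so this is what makes the rates
  along characteristics measurable.
\<close>

lemma caratheodory_measurable:
  fixes f :: "real \<Rightarrow> real \<Rightarrow> real" and G :: "real \<Rightarrow> real"
  assumes f_meas: "\<And>J. J \<in> {0..b} \<Longrightarrow> (\<lambda>s. f s J) \<in> borel_measurable lebesgue"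
    and f_cont: "AE s in lebesgue. continuous_on {0..b} (f s)"
    and G_meas [measurable]: "G \<in> borel_measurable lebesgue"
    and G_range: "\<And>s. G s \<in> {0..b}"
  shows "(\<lambda>s. f s (G s)) \<in> borel_measurable lebesgue"
proof -
  have b: "0 \<le> b"
    using G_range[of 0] by simp
  \<comment> \<open>G is rounded down to multiples of 1 / (m + 1); truncation keeps the values in {0..b}.\<close>
  define clip where "clip y = min b (max 0 y)" for y :: real
  define g where "g m s = clip (real_of_int \<lfloor>real (Suc m) * G s\<rfloor> / real (Suc m))" for m s
  have clip_range: "clip y \<in> {0..b}" for y
    using b by (auto simp: clip_def)
  have fg_meas: "(\<lambda>s. f s (g m s)) \<in> borel_measurable lebesgue" for m
    unfolding g_def
    by (rule measurable_compose_countable[where g = "\<lambda>s. \<lfloor>real (Suc m) * G s\<rfloor>"])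
       (use f_meas clip_range in auto)
  have g_lim: "(\<lambda>m. g m s) \<longlonglongrightarrow> G s" for s
  proof -
    have "\<bar>g m s - G s\<bar> \<le> 1 / real (Suc m)" for m
    proof -
      let ?y = "real_of_int \<lfloor>real (Suc m) * G s\<rfloor> / real (Suc m)"
      have "\<bar>g m s - G s\<bar> \<le> \<bar>?y - G s\<bar>"
        using G_range[of s] by (auto simp: g_def clip_def)
      also have "?y - G s = (real_of_int \<lfloor>real (Suc m) * G s\<rfloor> - real (Suc m) * G s) / real (Suc m)"
        by (simp add: diff_divide_distrib del: of_nat_Suc)
      also have "\<bar>\<dots>\<bar> = \<bar>real_of_int \<lfloor>real (Suc m) * G s\<rfloor> - real (Suc m) * G s\<bar> / real (Suc m)"
        by simp
      also have "\<dots> \<le> 1 / real (Suc m)"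
        by (intro divide_right_mono) linarith+
      finally show ?thesis .
    qed
    then have "(\<lambda>m. g m s - G s) \<longlonglongrightarrow> 0"
      by (intro Lim_null_comparison[OF _ LIMSEQ_inverse_real_of_nat])
         (auto simp: inverse_eq_divide)
    then show ?thesis
      by (simp add: LIM_zero_iff)
  qed
  obtain N where N: "N \<in> null_sets lebesgue" "\<And>s. s \<notin> N \<Longrightarrow> continuous_on {0..b} (f s)"
    using f_cont unfolding completion.AE_iff_null_sets by auto
  have "(\<lambda>s. if s \<in> N then 0 else f s (G s)) \<in> borel_measurable lebesgue"
  proof (rule borel_measurable_LIMSEQ_metric)
    show "(\<lambda>s. if s \<in> N then 0 else f s (g m s)) \<in> borel_measurable lebesgue" for m
      using N fg_meas by (intro measurable_If_set) auto
    fix s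
    show "(\<lambda>m. if s \<in> N then 0 else f s (g m s)) \<longlonglongrightarrow> (if s \<in> N then 0 else f s (G s))"
    proof (cases "s \<in> N")
      case False
      then have "(\<lambda>m. f s (g m s)) \<longlonglongrightarrow> f s (G s)"
        using continuous_on_tendsto_compose[OF N(2)[OF False] g_lim[of s] G_range[of s]]
          clip_range by (simp add: g_def)
      then show ?thesis using False by simp
    qed simp
  qed
  moreover have "AE s in lebesgue. (if s \<in> N then 0 else f s (G s)) = f s (G s)"
    using AE_not_in[OF N(1)] by eventually_elim simp
  ultimately show ?thesis
    by (rule borel_measurable_AE)
qed

lemma AE_lebesgue_section:
  fixes P :: "real \<Rightarrow> real \<Rightarrow> bool"
  assumes "AE (x, J) in lebesgue_on ({0<..} \<times> {0<..<b}). P x J"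
  shows "AE x in lebesgue. 0 < x \<longrightarrow> (AE J in lebesgue. 0 < J \<and> J < b \<longrightarrow> P x J)"
proof -
  let ?Q = "\<lambda>p. p \<in> {0<..} \<times> {0<..<b} \<longrightarrow> (case p of (x, J) \<Rightarrow> P x J)"
  have "{0<..} \<times> {0<..<b} \<in> sets (borel :: (real \<times> real) measure)"
    by (intro borel_open open_Times) auto
  then have "AE p in lebesgue. ?Q p"
    using assms by (subst (asm) AE_restrict_space_iff) auto
  then have "AE p in (lborel :: real measure) \<Otimes>\<^sub>M (lborel :: real measure). ?Q p"
    unfolding lborel_prod AE_completion_iff .
  then have "AE x in lborel. AE J in lborel. ?Q (x, J)"
    by (rule lborel_pair.AE_pair)
  then have "AE x in lborel. 0 < x \<longrightarrow> (AE J in lborel. 0 < J \<and> J < b \<longrightarrow> P x J)"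
    by eventually_elim auto
  then show ?thesis
    by (simp add: AE_completion_iff)
qed

text \<open>
  By Fubini, the bounds on the partial derivative hold on almost every section, where they can be
  integrated. This is how \<open>\<partial>r/\<partial>I\<close> enters: the rate is antitone and Lipschitz in
  the activity, for almost every age.
\<close>

lemma partial_derivative_bounds_increments:
  fixes r g :: "real \<Rightarrow> real \<Rightarrow> real"
  assumes g: "has_partial_I b r g"
    and bounded: "AE (x, J) in lebesgue_on ({0<..} \<times> {0<..<b}). \<bar>g x J\<bar> \<le> C"
    and nonpos: "AE (x, J) in lebesgue_on ({0<..} \<times> {0<..<b}). g x J \<le> 0"
  shows "AE x in lebesgue. 0 < x \<longrightarrow>
    (\<forall>u v. 0 \<le> u \<and> u \<le> v \<and> v \<le> b \<longrightarrow> r x v \<le> r x u \<and> r x u - r x v \<le> C * (v - u))"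
proof -
  have "AE x in lebesgue. 0 < x \<longrightarrow>
        (\<forall>u v. 0 \<le> u \<and> u \<le> v \<and> v \<le> b \<longrightarrow>
           set_integrable lebesgue {u<..<v} (g x) \<and>
           r x v - r x u = (LINT J:{u<..<v}|lebesgue. g x J))"
    using g by (simp add: has_partial_I_def)
  with AE_lebesgue_section[OF bounded] AE_lebesgue_section[OF nonpos]
  show ?thesis
  proof eventually_elim
    case (elim x)
    show ?case
    proof (intro impI allI, elim conjE)
      fix u v assume x: "0 < x" and uv: "0 \<le> u" "u \<le> v" "v \<le> b"
      have int: "set_integrable lebesgue {u<..<v} (g x)"
        and eq: "r x v - r x u = (LINT J:{u<..<v}|lebesgue. g x J)"
        using elim x uv by auto
      have const: "set_integrable lebesgue {u<..<v} (\<lambda>J. c)" for c :: real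
        unfolding set_integrable_def
        by (intro integrable_scaleR_left) (simp add: emeasure_lborel_Ioo[OF uv(2)])
      have const_val: "(LINT J:{u<..<v}|lebesgue. c) = c * (v - u)" for c :: real
        using uv by (simp add: set_integral_const)
      have "AE J in lebesgue. 0 < J \<and> J < b \<longrightarrow> \<bar>g x J\<bar> \<le> C"
        "AE J in lebesgue. 0 < J \<and> J < b \<longrightarrow> g x J \<le> 0"
        using elim x by auto
      then have upper: "AE J \<in> {u<..<v} in lebesgue. g x J \<le> 0"
        and lower: "AE J \<in> {u<..<v} in lebesgue. - C \<le> g x J"
        using uv by (auto elim: eventually_elim2)
      from set_integral_mono_AE[OF int const upper] set_integral_mono_AE[OF const int lower]
      show "r x v \<le> r x u \<and> r x u - r x v \<le> C * (v - u)"
        unfolding const_val eq[symmetric] by simp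
    qed
  qed
qed

text \<open>
  The last two assumptions state the regularity in the activity in the form in which it is used: almost
  every section is antitone and \<open>C\<close>-Lipschitz.
\<close>

locale firing_rate =
  fixes r\<^sub>M r\<^sub>0 C :: real and r :: "real \<Rightarrow> real \<Rightarrow> real"
  assumes rM_pos: "0 < r\<^sub>M" and r0_pos: "0 < r\<^sub>0" and C_nonneg: "0 \<le> C"
    and r_meas: "\<And>J. J \<in> {0..r\<^sub>M} \<Longrightarrow> (\<lambda>x. r x J) \<in> borel_measurable (lebesgue_on {0<..})"
    and r_lower: "\<And>x J. 0 < x \<Longrightarrow> J \<in> {0..r\<^sub>M} \<Longrightarrow> r\<^sub>0 \<le> r x J"
    and r_upper: "\<And>x J. 0 < x \<Longrightarrow> J \<in> {0..r\<^sub>M} \<Longrightarrow> r x J \<le> r\<^sub>M"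
    and r_antitone: "AE x in lebesgue. 0 < x \<longrightarrow>
      (\<forall>a\<in>{0..r\<^sub>M}. \<forall>b\<in>{0..r\<^sub>M}. a \<le> b \<longrightarrow> r x b \<le> r x a)"
    and r_lipschitz: "AE x in lebesgue. 0 < x \<longrightarrow>
      (\<forall>a\<in>{0..r\<^sub>M}. \<forall>b\<in>{0..r\<^sub>M}. \<bar>r x a - r x b\<bar> \<le> C * \<bar>a - b\<bar>)"
begin

lemma r0_le_rM: "r\<^sub>0 \<le> r\<^sub>M"
  using r_lower[of 1 0] r_upper[of 1 0] rM_pos by simp

text \<open>
  Along the characteristic that starts at age \<open>c\<close>, a neuron experiences the rate \<open>r (c + s) (G s)\<close>, where
  \<open>G\<close> is the delayed activity. An initial neuron has \<open>c = x - t\<close>, a newborn one \<open>c = 0\<close>.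
\<close>

lemma rate_along_measurable:
  assumes c: "0 \<le> c" and G: "G \<in> borel_measurable (lebesgue_on {0<..})"
    and G_range: "\<And>s. 0 < s \<Longrightarrow> G s \<in> {0..r\<^sub>M}"
  shows "(\<lambda>s. r (c + s) (G s)) \<in> borel_measurable (lebesgue_on {0<..})"
proof -
  let ?f = "\<lambda>s J. indicator {0<..} s * r (c + s) J"
  let ?G = "\<lambda>s. indicator {0<..} s * G s"
  have "(\<lambda>s. ?f s (?G s)) \<in> borel_measurable lebesgue"
  proof (rule caratheodory_measurable[where f = ?f and G = ?G and b = r\<^sub>M])
    \<comment> \<open>The values of the rate at nonpositive ages are arbitrary, hence the cut-offs.\<close>
    fix J assume J: "J \<in> {0..r\<^sub>M}"
    have "(\<lambda>s. indicator {0<..} s * r s J) \<in> borel_measurable lebesgue"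
      using r_meas[OF J] by (simp add: borel_measurable_restrict_space_iff)
    from borel_measurable_affine[OF this, of 1 c]
    have "(\<lambda>s. indicator {0<..} (c + s) * r (c + s) J) \<in> borel_measurable lebesgue"
      by simp
    then have "(\<lambda>s. indicator {0<..} s * (indicator {0<..} (c + s) * r (c + s) J))
        \<in> borel_measurable lebesgue"
      by (intro borel_measurable_times[OF borel_measurable_indicator]) auto
    also have "(\<lambda>s. indicator {0<..} s * (indicator {0<..} (c + s) * r (c + s) J)) = (\<lambda>s. ?f s J)"
      using c by (auto simp: fun_eq_iff indicator_def)
    finally show "(\<lambda>s. ?f s J) \<in> borel_measurable lebesgue" .
  next
    from AE_lebesgue_shift[OF r_lipschitz, of c]
    show "AE s in lebesgue. continuous_on {0..r\<^sub>M} (?f s)"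
    proof eventually_elim
      case (elim s)
      show ?case
      proof (cases "0 < s")
        case True
        then have "C-lipschitz_on {0..r\<^sub>M} (r (c + s))"
          using elim c C_nonneg by (intro lipschitz_onI) (auto simp: dist_real_def)
        then show ?thesis
          by (intro continuous_intros lipschitz_on_continuous_on)
      qed simp
    qed
  next
    show "?G \<in> borel_measurable lebesgue"
      using G by (simp add: borel_measurable_restrict_space_iff)
    show "?G s \<in> {0..r\<^sub>M}" for s
      using G_range[of s] rM_pos by (cases "0 < s") auto
  qed
  also have "(\<lambda>s. ?f s (?G s)) = (\<lambda>s. indicator {0<..} s * r (c + s) (G s))"
    by (auto simp: fun_eq_iff indicator_def)
  finally show ?thesis
    by (simp add: borel_measurable_restrict_space_iff)
qed

lemma rate_along_integrable:
  assumes "0 \<le> c" "G \<in> borel_measurable (lebesgue_on {0<..})"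
    and "\<And>s. 0 < s \<Longrightarrow> G s \<in> {0..r\<^sub>M}" and "0 \<le> a"
  shows "set_integrable lebesgue {a..b} (\<lambda>s. r (c + s) (G s))"
proof -
  have "set_integrable lebesgue {a<..b} (\<lambda>s. r (c + s) (G s))"
  proof (rule set_integrable_dominated)
    have "(\<lambda>s. r (c + s) (G s)) \<in> borel_measurable (restrict_space (lebesgue_on {0<..}) {a<..b})"
      using rate_along_measurable[OF assms(1-3)] by (rule measurable_restrict_space1)
    also have "restrict_space (lebesgue_on {0<..}) {a<..b} = lebesgue_on {a<..b}"
      using assms(4) by (subst restrict_restrict_space) (auto intro!: arg_cong2[where f = restrict_space])
    finally show "(\<lambda>s. r (c + s) (G s)) \<in> borel_measurable (lebesgue_on {a<..b})" .
    show "set_integrable lebesgue {a<..b} (\<lambda>_. r\<^sub>M)"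
      by (simp add: set_integral_half_open_closed set_integrable_const_Icc)
    show "AE s in lebesgue. s \<in> {a<..b} \<longrightarrow> \<bar>r (c + s) (G s)\<bar> \<le> r\<^sub>M"
    proof (intro AE_I2 impI)
      fix s assume "s \<in> {a<..b}"
      then have "0 < s" "0 < c + s" using assms by auto
      then show "\<bar>r (c + s) (G s)\<bar> \<le> r\<^sub>M"
        using r_lower[of "c + s" "G s"] r_upper[of "c + s" "G s"] assms(3)[of s] r0_pos by auto
    qed
  qed auto
  then show ?thesis
    by (simp add: set_integral_half_open_closed)
qed

lemma rate_along_bounds:
  assumes "0 \<le> c" "G \<in> borel_measurable (lebesgue_on {0<..})"
    and "\<And>s. 0 < s \<Longrightarrow> G s \<in> {0..r\<^sub>M}" and "0 \<le> a" "a \<le> b"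
  shows "r\<^sub>0 * (b - a) \<le> (LINT s:{a..b}|lebesgue. r (c + s) (G s)) \<and>
    (LINT s:{a..b}|lebesgue. r (c + s) (G s)) \<le> r\<^sub>M * (b - a)"
  using assms r_lower r_upper
  by (intro set_integral_bounds_Icc rate_along_integrable AE_I2) auto

lemma rate_along_diff:
  assumes c: "0 \<le> c" and G: "G \<in> borel_measurable (lebesgue_on {0<..})"
    and G_range: "\<And>s. 0 < s \<Longrightarrow> G s \<in> {0..r\<^sub>M}"
    and H: "H \<in> borel_measurable (lebesgue_on {0<..})"
    and H_range: "\<And>s. 0 < s \<Longrightarrow> H s \<in> {0..r\<^sub>M}"
    and close: "\<And>s. 0 < s \<Longrightarrow> s \<le> b \<Longrightarrow> \<bar>G s - H s\<bar> \<le> \<eta>" and b: "0 \<le> b"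
  shows "\<bar>(LINT s:{0..b}|lebesgue. r (c + s) (G s)) - (LINT s:{0..b}|lebesgue. r (c + s) (H s))\<bar>
    \<le> C * \<eta> * b"
proof -
  note int = rate_along_integrable[OF c G G_range order_refl, of b]
    rate_along_integrable[OF c H H_range order_refl, of b]
  have "- (C * \<eta>) * (b - 0) \<le> (LINT s:{0..b}|lebesgue. r (c + s) (G s) - r (c + s) (H s)) \<and>
      (LINT s:{0..b}|lebesgue. r (c + s) (G s) - r (c + s) (H s)) \<le> C * \<eta> * (b - 0)"
  proof (rule set_integral_bounds_Icc[OF set_integral_diff(1) b])
    from AE_lebesgue_shift[OF r_lipschitz, of c]
    show "AE s in lebesgue. 0 < s \<and> s \<le> b \<longrightarrow>
      - (C * \<eta>) \<le> r (c + s) (G s) - r (c + s) (H s) \<and>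
      r (c + s) (G s) - r (c + s) (H s) \<le> C * \<eta>"
    proof eventually_elim
      case (elim s)
      show ?case
      proof
        assume s: "0 < s \<and> s \<le> b"
        then have "\<bar>r (c + s) (G s) - r (c + s) (H s)\<bar> \<le> C * \<bar>G s - H s\<bar>"
          using elim c G_range[of s] H_range[of s] by auto
        also have "\<dots> \<le> C * \<eta>"
          using close[of s] s C_nonneg by (intro mult_left_mono) auto
        finally show "- (C * \<eta>) \<le> r (c + s) (G s) - r (c + s) (H s) \<and>
            r (c + s) (G s) - r (c + s) (H s) \<le> C * \<eta>" by auto
      qed
    qed
  qed (use int in auto)
  then show ?thesis
    using int by (subst set_integral_diff(2)[symmetric]) (auto simp: abs_le_iff)
qed

abbreviation survival :: "real \<Rightarrow> real \<Rightarrow> real" where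
  "survival J x \<equiv> exp (- firing_R r x J)"

lemma firing_R_Icc: "firing_R r x J = (LINT y:{0..x}|lebesgue. r (0 + y) J)"
  by (simp add: firing_R_def set_integral_half_open_closed)

lemma r_integrable_Icc:
  assumes "J \<in> {0..r\<^sub>M}" "0 \<le> a"
  shows "set_integrable lebesgue {a..b} (\<lambda>s. r s J)"
  using rate_along_integrable[of 0 "\<lambda>_. J" a b] assms by simp

lemma firing_R_increment:
  assumes J: "J \<in> {0..r\<^sub>M}" and "0 \<le> a" "a \<le> b"
  shows "firing_R r b J - firing_R r a J = (LINT s:{a..b}|lebesgue. r s J)"
    and "r\<^sub>0 * (b - a) \<le> firing_R r b J - firing_R r a J"
    and "firing_R r b J - firing_R r a J \<le> r\<^sub>M * (b - a)"
    and "firing_R r a J \<le> firing_R r b J"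
proof -
  have "{0<..b} = {0<..a} \<union> {a<..b}" using assms by auto
  moreover have "(LINT s:{0<..a} \<union> {a<..b}|lebesgue. r s J) =
      (LINT s:{0<..a}|lebesgue. r s J) + (LINT s:{a<..b}|lebesgue. r s J)"
    using assms
    by (intro set_integral_Un) (auto simp: set_integral_half_open_closed r_integrable_Icc)
  ultimately show eq: "firing_R r b J - firing_R r a J = (LINT s:{a..b}|lebesgue. r s J)"
    by (simp add: firing_R_def set_integral_half_open_closed)
  show "r\<^sub>0 * (b - a) \<le> firing_R r b J - firing_R r a J"
    "firing_R r b J - firing_R r a J \<le> r\<^sub>M * (b - a)"
    using rate_along_bounds[of 0 "\<lambda>_. J" a b] assms by (simp_all add: eq)
  moreover have "0 \<le> r\<^sub>0 * (b - a)"
    using r0_pos assms by simp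
  ultimately show "firing_R r a J \<le> firing_R r b J" by linarith
qed

lemma firing_R_zero: "firing_R r 0 J = 0"
  by (simp add: firing_R_def set_lebesgue_integral_def)

lemma firing_R_bounds:
  assumes "J \<in> {0..r\<^sub>M}" "0 \<le> x"
  shows "r\<^sub>0 * x \<le> firing_R r x J" "firing_R r x J \<le> r\<^sub>M * x" "0 \<le> firing_R r x J"
  using firing_R_increment(2-4)[OF assms(1) order_refl assms(2)] firing_R_zero[of J] by auto

lemma survival_bounds:
  assumes "J \<in> {0..r\<^sub>M}" "0 \<le> x"
  shows "exp (- (r\<^sub>M * x)) \<le> survival J x" "survival J x \<le> exp (- (r\<^sub>0 * x))" "survival J x \<le> 1"
  using firing_R_bounds[OF assms] by auto

lemma survival_continuous:
  assumes J: "J \<in> {0..r\<^sub>M}"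
  shows "continuous_on {0..} (survival J)"
proof -
  have "\<bar>firing_R r x J - firing_R r y J\<bar> \<le> r\<^sub>M * \<bar>x - y\<bar>" if "0 \<le> x" "0 \<le> y" for x y
    using firing_R_increment(3,4)[OF J that(1), of y] firing_R_increment(3,4)[OF J that(2), of x]
    by (cases "x \<le> y") (auto simp: abs_if)
  then have "r\<^sub>M-lipschitz_on {0..} (\<lambda>x. firing_R r x J)"
    using rM_pos by (intro lipschitz_onI) (auto simp: dist_real_def)
  then show ?thesis
    by (intro continuous_intros lipschitz_on_continuous_on)
qed

lemma survival_measurable:
  assumes "J \<in> {0..r\<^sub>M}"
  shows "survival J \<in> borel_measurable (lebesgue_on {0<..})"
  by (intro continuous_imp_measurable_on_sets_lebesgue
      continuous_on_subset[OF survival_continuous[OF assms]]) auto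

lemma exp_decay_integrable_pos: "set_integrable lebesgue {0<..} (\<lambda>x. exp (- (r\<^sub>0 * x)))"
  using exp_decay_integrable[OF r0_pos, of 0] by (simp add: set_integral_open_closed_ray)

lemma survival_weighted_integrable:
  assumes J: "J \<in> {0..r\<^sub>M}" and w: "w \<in> borel_measurable (lebesgue_on {0<..})"
    and bound: "\<And>x. 0 < x \<Longrightarrow> \<bar>w x\<bar> \<le> B"
  shows "set_integrable lebesgue {0<..} (\<lambda>x. w x * survival J x)"
proof (rule set_integrable_dominated)
  show "(\<lambda>x. w x * survival J x) \<in> borel_measurable (lebesgue_on {0<..})"
    by (intro borel_measurable_times w survival_measurable[OF J])
  show "set_integrable lebesgue {0<..} (\<lambda>x. B * exp (- (r\<^sub>0 * x)))"
    using exp_decay_integrable_pos by simp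
  have "\<bar>w x * survival J x\<bar> \<le> B * exp (- (r\<^sub>0 * x))" if "0 < x" for x
    using bound[OF that] survival_bounds[OF J, of x] that
    by (auto simp: abs_mult intro!: mult_mono)
  then show "AE x in lebesgue. x \<in> {0<..} \<longrightarrow> \<bar>w x * survival J x\<bar> \<le> B * exp (- (r\<^sub>0 * x))"
    by (intro AE_I2) auto
qed auto

lemma survival_integrable:
  "J \<in> {0..r\<^sub>M} \<Longrightarrow> set_integrable lebesgue {0<..} (survival J)"
  using survival_weighted_integrable[of J "\<lambda>_. 1" 1] by simp

lemma abs_rate_le: "0 < x \<Longrightarrow> J \<in> {0..r\<^sub>M} \<Longrightarrow> \<bar>r x J\<bar> \<le> r\<^sub>M"
  using r_lower[of x J] r_upper[of x J] r0_pos by auto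

lemma rate_survival_integrable:
  "J \<in> {0..r\<^sub>M} \<Longrightarrow> set_integrable lebesgue {0<..} (\<lambda>x. r x J * survival J x)"
  by (rule survival_weighted_integrable[OF _ r_meas abs_rate_le])

text \<open>
  Every neuron either survives to age \<open>x\<close> or fires before. Over \<open>[a, b]\<close> the increment of the left-hand
  side splits into \<open>\<integral> r (S - S a)\<close> and \<open>S a (exp (- \<rho>) - 1 + \<rho>)\<close> with \<open>\<rho> = \<integral> r\<close>; both are
  quadratically small in \<open>b - a\<close>, so the left-hand side is constant.
\<close>

lemma survival_balance_Icc:
  assumes J: "J \<in> {0..r\<^sub>M}" and x: "0 \<le> x"
  shows "survival J x + (LINT s:{0..x}|lebesgue. r s J * survival J s) = 1"
proof -
  let ?S = "survival J"
  define F where "F x = ?S x + (LINT s:{0<..x}|lebesgue. r s J * ?S s)" for x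
  have int: "set_integrable lebesgue {a..b} (\<lambda>s. r s J * ?S s)" if "0 \<le> a" for a b
    using set_integrable_subset[OF rate_survival_integrable[OF J], of "{a<..b}"] that
    by (simp add: set_integral_half_open_closed subset_iff)
  have "F x = F 0"
  proof (rule constant_if_quadratic_increments[where K = "2 * r\<^sub>M * r\<^sub>M", OF _ x])
    fix a b :: real assume ab: "0 \<le> a" "a \<le> b"
    define \<rho> where "\<rho> = firing_R r b J - firing_R r a J"
    have \<rho>: "0 \<le> \<rho>" "\<rho> \<le> r\<^sub>M * (b - a)" "\<rho> = (LINT s:{a..b}|lebesgue. r s J)"
      using firing_R_increment[OF J ab] by (auto simp: \<rho>_def)
    have "{0<..b} = {0<..a} \<union> {a<..b}" using ab by auto
    moreover have "(LINT s:{0<..a} \<union> {a<..b}|lebesgue. r s J * ?S s) =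
        (LINT s:{0<..a}|lebesgue. r s J * ?S s) + (LINT s:{a<..b}|lebesgue. r s J * ?S s)"
      using ab int by (intro set_integral_Un) (auto simp: set_integral_half_open_closed)
    ultimately have "F b - F a = ?S b - ?S a + (LINT s:{a..b}|lebesgue. r s J * ?S s)"
      by (simp add: F_def set_integral_half_open_closed)
    also have "(LINT s:{a..b}|lebesgue. r s J * ?S s) =
        (LINT s:{a..b}|lebesgue. r s J * (?S s - ?S a)) + ?S a * \<rho>"
      unfolding \<rho>(3) using int[OF ab(1), of b] r_integrable_Icc[OF J ab(1), of b]
      by (simp add: right_diff_distrib set_integral_diff mult.commute)
    also have "?S b - ?S a = ?S a * (exp (- \<rho>) - 1)"
      by (simp add: \<rho>_def right_diff_distrib flip: exp_add)
    finally have eq: "F b - F a = (LINT s:{a..b}|lebesgue. r s J * (?S s - ?S a))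
        + ?S a * (exp (- \<rho>) - 1 + \<rho>)"
      by (simp add: algebra_simps)
    let ?K = "r\<^sub>M * r\<^sub>M * (b - a)"
    have pointwise: "\<bar>r s J * (?S s - ?S a)\<bar> \<le> ?K" if "a < s" "s \<le> b" for s
    proof -
      have "\<bar>?S s - ?S a\<bar> \<le> \<bar>firing_R r s J - firing_R r a J\<bar>"
        using firing_R_bounds[OF J] ab that by (intro abs_exp_neg_diff_le) auto
      also have "\<dots> \<le> r\<^sub>M * (b - a)"
        using firing_R_increment(3,4)[OF J, of a s] that ab
          mult_left_mono[of "s - a" "b - a" r\<^sub>M] rM_pos by linarith
      finally have "\<bar>?S s - ?S a\<bar> \<le> r\<^sub>M * (b - a)" .
      moreover have "\<bar>r s J\<bar> \<le> r\<^sub>M"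
        using abs_rate_le[of s J] J that ab by simp
      ultimately have "\<bar>r s J\<bar> * \<bar>?S s - ?S a\<bar> \<le> r\<^sub>M * (r\<^sub>M * (b - a))"
        using rM_pos by (intro mult_mono) auto
      then show ?thesis
        by (simp only: abs_mult mult.assoc)
    qed
    have "set_integrable lebesgue {a..b} (\<lambda>s. r s J * (?S s - ?S a))"
      using int[OF ab(1), of b] r_integrable_Icc[OF J ab(1), of b]
      by (auto simp: right_diff_distrib intro!: set_integral_diff(1))
    moreover have "AE s in lebesgue. a < s \<and> s \<le> b \<longrightarrow>
        - ?K \<le> r s J * (?S s - ?S a) \<and> r s J * (?S s - ?S a) \<le> ?K"
    proof (intro AE_I2 impI)
      fix s assume "a < s \<and> s \<le> b"
      then show "- ?K \<le> r s J * (?S s - ?S a) \<and> r s J * (?S s - ?S a) \<le> ?K"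
        using pointwise[of s] by linarith
    qed
    ultimately have "- ?K * (b - a) \<le> (LINT s:{a..b}|lebesgue. r s J * (?S s - ?S a)) \<and>
        (LINT s:{a..b}|lebesgue. r s J * (?S s - ?S a)) \<le> ?K * (b - a)"
      by (intro set_integral_bounds_Icc ab(2))
    then have "\<bar>LINT s:{a..b}|lebesgue. r s J * (?S s - ?S a)\<bar> \<le> ?K * (b - a)"
      by (auto simp: abs_le_iff)
    moreover have "\<bar>?S a * (exp (- \<rho>) - 1 + \<rho>)\<bar> \<le> ?K * (b - a)"
    proof -
      have nonneg: "0 \<le> exp (- \<rho>) - 1 + \<rho>"
        using exp_ge_add_one_self[of "- \<rho>"] by simp
      have "(1 + \<rho>) * exp (- \<rho>) \<le> exp \<rho> * exp (- \<rho>)"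
        using exp_ge_add_one_self[of \<rho>] by (intro mult_right_mono) auto
      then have "(1 + \<rho>) * exp (- \<rho>) \<le> 1"
        by (simp only: exp_minus_inverse)
      moreover have "\<rho> * (1 + - \<rho>) \<le> \<rho> * exp (- \<rho>)"
        using exp_ge_add_one_self[of "- \<rho>"] \<rho>(1) by (intro mult_left_mono)
      ultimately have "exp (- \<rho>) - 1 + \<rho> \<le> \<rho> * \<rho>"
        by (simp add: algebra_simps)
      also have "\<dots> \<le> (r\<^sub>M * (b - a)) * (r\<^sub>M * (b - a))"
        using \<rho> by (intro mult_mono) auto
      finally have "?S a * (exp (- \<rho>) - 1 + \<rho>) \<le> 1 * ((r\<^sub>M * (b - a)) * (r\<^sub>M * (b - a)))"
        using nonneg survival_bounds(3)[OF J ab(1)] by (intro mult_mono) auto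
      then show ?thesis
        using nonneg by (simp add: abs_mult mult_ac)
    qed
    ultimately show "\<bar>F b - F a\<bar> \<le> 2 * r\<^sub>M * r\<^sub>M * (b - a)\<^sup>2"
      unfolding eq power2_eq_square mult.assoc by linarith
  qed
  moreover have "F 0 = 1"
    by (simp add: F_def firing_R_zero set_lebesgue_integral_def)
  ultimately show ?thesis
    by (simp add: F_def set_integral_half_open_closed)
qed

text \<open>
  Every neuron fires eventually. This is the normalisation behind both \<open>\<integral> r(x, J) nbar(x, J) dx = Phi J\<close>
  and the contraction factor.
\<close>

lemma survival_balance:
  assumes J: "J \<in> {0..r\<^sub>M}"
  shows "(LINT s:{0<..}|lebesgue. r s J * survival J s) = 1"
proof -
  let ?f = "\<lambda>s. r s J * survival J s"
  have "((\<lambda>x. LINT s:{0..x}|lebesgue. ?f s) \<longlongrightarrow> (LINT s:{0..}|lebesgue. ?f s)) at_top"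
    using rate_survival_integrable[OF J]
    by (intro tendsto_set_lebesgue_integral_at_top) (auto simp: set_integral_open_closed_ray)
  moreover have "((\<lambda>x. LINT s:{0..x}|lebesgue. ?f s) \<longlongrightarrow> 1) at_top"
  proof -
    have "((\<lambda>x. exp (- (r\<^sub>0 * x))) \<longlongrightarrow> 0) at_top"
      using r0_pos by real_asymp
    then have "((\<lambda>x. survival J x) \<longlongrightarrow> 0) at_top"
    proof (rule Lim_null_comparison[rotated])
      show "\<forall>\<^sub>F x in at_top. norm (survival J x) \<le> exp (- (r\<^sub>0 * x))"
        using eventually_ge_at_top[of 0] by eventually_elim (use survival_bounds(2)[OF J] in auto)
    qed
    from tendsto_diff[OF tendsto_const[of 1] this]
    have "((\<lambda>x. 1 - survival J x) \<longlongrightarrow> 1) at_top" by simp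
    moreover have "\<forall>\<^sub>F x in at_top. 1 - survival J x = (LINT s:{0..x}|lebesgue. ?f s)"
      using eventually_ge_at_top[of 0]
      by eventually_elim (use survival_balance_Icc[OF J] in \<open>auto simp: algebra_simps\<close>)
    ultimately show ?thesis
      by (rule Lim_transform_eventually)
  qed
  ultimately have "(LINT s:{0..}|lebesgue. ?f s) = 1"
    by (rule tendsto_unique[OF trivial_limit_at_top_linorder])
  then show ?thesis
    by (simp add: set_integral_open_closed_ray)
qed

end

section \<open>Stationary profiles and the map Phi\<close>

context firing_rate
begin

lemma firing_R_antitone:
  assumes "0 \<le> a" "a \<le> b" "b \<le> r\<^sub>M" and x: "0 \<le> x"
  shows "firing_R r x b \<le> firing_R r x a"
proof -
  have ab: "a \<in> {0..r\<^sub>M}" "b \<in> {0..r\<^sub>M}" using assms by auto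
  have "AE s \<in> {0<..x} in lebesgue. r s b \<le> r s a"
    using r_antitone by eventually_elim (use ab assms in auto)
  then show ?thesis
    unfolding firing_R_def using ab
    by (intro set_integral_mono_AE) (auto simp: set_integral_half_open_closed r_integrable_Icc)
qed

lemma firing_R_lipschitz:
  assumes "a \<in> {0..r\<^sub>M}" "b \<in> {0..r\<^sub>M}" "0 \<le> x"
  shows "\<bar>firing_R r x a - firing_R r x b\<bar> \<le> C * \<bar>a - b\<bar> * x"
  using rate_along_diff[of 0 "\<lambda>_. a" "\<lambda>_. b" x "\<bar>a - b\<bar>"] assms
  by (simp add: firing_R_Icc)

lemma total_survival_bounds:
  assumes J: "J \<in> {0..r\<^sub>M}"
  shows "1 / r\<^sub>M \<le> (LINT x:{0<..}|lebesgue. survival J x)"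
    and "(LINT x:{0<..}|lebesgue. survival J x) \<le> 1 / r\<^sub>0"
proof -
  have int: "set_integrable lebesgue {0<..} (\<lambda>x. exp (- (a * x)))"
    and val: "(LINT x:{0<..}|lebesgue. exp (- (a * x))) = 1 / a" if "0 < a" for a :: real
    using exp_decay_integrable[OF that, of 0] exp_decay_integral[OF that, of 0]
    by (simp_all add: set_integral_open_closed_ray)
  have "(LINT x:{0<..}|lebesgue. exp (- (r\<^sub>M * x))) \<le> (LINT x:{0<..}|lebesgue. survival J x)"
    using survival_bounds(1)[OF J]
    by (intro set_integral_mono int rM_pos survival_integrable J) auto
  then show "1 / r\<^sub>M \<le> (LINT x:{0<..}|lebesgue. survival J x)"
    by (simp add: val rM_pos)
  have "(LINT x:{0<..}|lebesgue. survival J x) \<le> (LINT x:{0<..}|lebesgue. exp (- (r\<^sub>0 * x)))"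
    using survival_bounds(2)[OF J]
    by (intro set_integral_mono int r0_pos survival_integrable J) auto
  then show "(LINT x:{0<..}|lebesgue. survival J x) \<le> 1 / r\<^sub>0"
    by (simp add: val r0_pos)
qed

lemma total_survival_pos:
  assumes "J \<in> {0..r\<^sub>M}"
  shows "0 < (LINT x:{0<..}|lebesgue. survival J x)"
  by (rule less_le_trans[OF _ total_survival_bounds(1)[OF assms]]) (simp add: rM_pos)

lemma Phi_bounds:
  assumes J: "J \<in> {0..r\<^sub>M}"
  shows "r\<^sub>0 \<le> Phi r J" "Phi r J \<le> r\<^sub>M" "Phi r J \<in> {0..r\<^sub>M}"
proof -
  show 1: "r\<^sub>0 \<le> Phi r J"
    using le_imp_inverse_le[OF total_survival_bounds(2)[OF J] total_survival_pos[OF J]]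
    by (simp add: Phi_def)
  show 2: "Phi r J \<le> r\<^sub>M"
    using le_imp_inverse_le[OF total_survival_bounds(1)[OF J]] rM_pos
    by (simp add: Phi_def)
  show "Phi r J \<in> {0..r\<^sub>M}"
    using 1 2 r0_pos by auto
qed

lemma total_survival_Phi: "(LINT x:{0<..}|lebesgue. survival J x) = 1 / Phi r J"
  by (simp add: Phi_def inverse_eq_divide)

lemma Phi_antitone:
  assumes ab: "0 \<le> a" "a \<le> b" "b \<le> r\<^sub>M"
  shows "Phi r b \<le> Phi r a"
proof -
  have "(LINT x:{0<..}|lebesgue. survival a x) \<le> (LINT x:{0<..}|lebesgue. survival b x)"
    using ab firing_R_antitone[OF ab] by (intro set_integral_mono survival_integrable) auto
  then show ?thesis
    unfolding Phi_def using ab by (intro le_imp_inverse_le total_survival_pos) auto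
qed

lemma Phi_continuous: "continuous_on {0..r\<^sub>M} (Phi r)"
proof -
  have "continuous_on {0..r\<^sub>M} (\<lambda>J. LINT x:{0<..}|lebesgue. survival J x)"
    unfolding continuous_on_sequentially comp_def
  proof (intro allI ballI impI, elim conjE)
    fix X :: "nat \<Rightarrow> real" and J
    assume J: "J \<in> {0..r\<^sub>M}" and X: "\<forall>n. X n \<in> {0..r\<^sub>M}" "X \<longlonglongrightarrow> J"
    show "(\<lambda>n. LINT x:{0<..}|lebesgue. survival (X n) x) \<longlonglongrightarrow> (LINT x:{0<..}|lebesgue. survival J x)"
      unfolding set_lebesgue_integral_def
    proof (rule integral_dominated_convergence)
      show "(\<lambda>x. indicator {0<..} x *\<^sub>R survival J x) \<in> borel_measurable lebesgue"
        using survival_integrable[OF J] by (auto simp: set_integrable_def)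
      show "(\<lambda>x. indicator {0<..} x *\<^sub>R survival (X n) x) \<in> borel_measurable lebesgue" for n
        using survival_integrable[of "X n"] X by (auto simp: set_integrable_def)
      show "integrable lebesgue (\<lambda>x. indicator {0<..} x *\<^sub>R exp (- (r\<^sub>0 * x)))"
        using exp_decay_integrable_pos by (simp add: set_integrable_def)
      show "AE x in lebesgue. norm (indicator {0<..} x *\<^sub>R survival (X n) x)
          \<le> indicator {0<..} x *\<^sub>R exp (- (r\<^sub>0 * x))" for n
        using survival_bounds(2)[of "X n"] X by (auto simp: indicator_def)
      show "AE x in lebesgue. (\<lambda>n. indicator {0<..} x *\<^sub>R survival (X n) x)
          \<longlonglongrightarrow> indicator {0<..} x *\<^sub>R survival J x"
      proof (intro AE_I2)
        fix x :: real
        show "(\<lambda>n. indicator {0<..} x *\<^sub>R survival (X n) x) \<longlonglongrightarrow> indicator {0<..} x *\<^sub>R survival J x"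
        proof (cases "0 < x")
          case True
          have bound: "norm (firing_R r x (X k) - firing_R r x J) \<le> C * \<bar>X k - J\<bar> * x" for k
            using firing_R_lipschitz[of "X k" J x] J X(1) True by simp
          have "(\<lambda>k. C * \<bar>X k - J\<bar> * x) \<longlonglongrightarrow> C * \<bar>J - J\<bar> * x"
            by (intro tendsto_intros X)
          then have "(\<lambda>k. C * \<bar>X k - J\<bar> * x) \<longlonglongrightarrow> 0"
            by simp
          then have "(\<lambda>k. firing_R r x (X k) - firing_R r x J) \<longlonglongrightarrow> 0"
            by (rule Lim_null_comparison[OF always_eventually[OF allI[OF bound]]])
          then have "(\<lambda>n. firing_R r x (X n)) \<longlonglongrightarrow> firing_R r x J"
            by (simp add: LIM_zero_iff)
          then show ?thesis
            by (intro tendsto_intros)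
        qed simp
      qed
    qed
  qed
  then have "continuous_on {0..r\<^sub>M} (\<lambda>J. inverse (LINT x:{0<..}|lebesgue. survival J x))"
    using total_survival_pos by (intro continuous_intros) (auto simp: less_le)
  then show ?thesis
    by (simp add: Phi_def[abs_def])
qed

lemma nbar_nonneg: "J \<in> {0..r\<^sub>M} \<Longrightarrow> 0 \<le> nbar r x J"
  using Phi_bounds(3)[of J] by (simp add: nbar_def)

lemma nbar_le:
  assumes "J \<in> {0..r\<^sub>M}" "0 < x"
  shows "nbar r x J \<le> r\<^sub>M * exp (- (r\<^sub>0 * x))"
  unfolding nbar_def using Phi_bounds[OF assms(1)] survival_bounds(2)[of J x] assms rM_pos
  by (intro mult_mono) auto

lemma nbar_integrable: "J \<in> {0..r\<^sub>M} \<Longrightarrow> set_integrable lebesgue {0<..} (\<lambda>x. nbar r x J)"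
  using survival_integrable[of J] by (simp add: nbar_def)

lemma nbar_integral:
  assumes "J \<in> {0..r\<^sub>M}"
  shows "(LINT x:{0<..}|lebesgue. nbar r x J) = 1"
  using Phi_bounds(1)[OF assms] r0_pos total_survival_Phi by (simp add: nbar_def)

lemma rate_nbar_eq: "r x J * nbar r x J = Phi r J * (r x J * survival J x)"
  by (simp add: nbar_def)

lemma rate_nbar_integrable:
  assumes "J \<in> {0..r\<^sub>M}"
  shows "set_integrable lebesgue {0<..} (\<lambda>x. r x J * nbar r x J)"
  unfolding rate_nbar_eq using rate_survival_integrable[OF assms] by simp

lemma rate_nbar_integral:
  assumes "J \<in> {0..r\<^sub>M}"
  shows "(LINT x:{0<..}|lebesgue. r x J * nbar r x J) = Phi r J"
  unfolding rate_nbar_eq using survival_balance[OF assms] by simp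

end

section \<open>Two-cycles of antitone maps\<close>

text \<open>
  The second iterate maps \<open>[0, b]\<close> into itself and crosses the diagonal at \<open>p\<close> with slope \<open>D\<^sup>2 > 1\<close>, so
  it lies below the diagonal just to the left of \<open>p\<close> but not at \<open>0\<close>. In between there is a fixed point \<open>u\<close> of
  the second iterate. Antitonicity puts \<open>f u\<close> on the other side of \<open>p\<close>.
\<close>

lemma antitone_two_cycle:
  fixes f :: "real \<Rightarrow> real"
  assumes cont: "continuous_on {0..b} f"
    and range: "\<And>x. x \<in> {0..b} \<Longrightarrow> f x \<in> {0..b}"
    and anti: "\<And>x y. 0 \<le> x \<Longrightarrow> x \<le> y \<Longrightarrow> y \<le> b \<Longrightarrow> f y \<le> f x"
    and p: "0 < p" "p \<le> b" "f p = p"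
    and deriv: "(f has_real_derivative D) (at p within {0..b})" and D: "D < - 1"
  shows "\<exists>u v. u \<in> {0..b} \<and> v \<in> {0..b} \<and> u < p \<and> p < v \<and> f u = v \<and> f v = u"
proof -
  have "(f \<circ> f has_real_derivative D * D) (at p within {0..b})"
  proof (rule DERIV_image_chain)
    show "(f has_real_derivative D) (at (f p) within f ` {0..b})"
      using deriv range p by (auto intro: DERIV_subset)
  qed (fact deriv)
  then have lim: "((\<lambda>y. ((f \<circ> f) y - p) / (y - p)) \<longlongrightarrow> D * D) (at p within {0..b})"
    using p by (simp add: has_field_derivative_iff)
  have "1 < D * D"
    using D mult_strict_mono'[of 1 "-D" 1 "-D"] by simp
  from order_tendstoD(1)[OF lim this]
  obtain e where e: "0 < e" "\<And>y. y \<in> {0..b} \<Longrightarrow> y \<noteq> p \<Longrightarrow> dist y p < e \<Longrightarrow> 1 < (f (f y) - p) / (y - p)"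
    unfolding eventually_at by auto
  define y where "y = max 0 (p - e / 2)"
  have y: "0 \<le> y" "y < p" "dist y p < e"
    using e p by (auto simp: y_def dist_real_def)
  have yg: "f (f y) < y"
    using e(2)[of y] y p by (auto simp: divide_simps split: if_splits)
  have "continuous_on {0..y} (\<lambda>x. f (f x) - x)"
    using y p range
    by (intro continuous_intros continuous_on_compose2[OF cont] continuous_on_subset[OF cont]) auto
  moreover have "0 \<le> f (f 0) - 0"
    using range[of 0] range[of "f 0"] p by auto
  ultimately obtain u where u: "0 \<le> u" "u \<le> y" "f (f u) - u = 0"
    using IVT2'[of "\<lambda>x. f (f x) - x" y 0 0] yg y by auto
  have "p \<le> f u"
    using anti[of u p] u y p by auto
  moreover have "f u \<noteq> p"
    using u y p by auto
  ultimately have "p < f u" by simp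
  then show ?thesis
    using u y p range[of u] by (intro exI[of _ u] exI[of _ "f u"]) auto
qed

section \<open>Solutions close to a stationary profile\<close>

context firing_rate
begin

text \<open>
  The part of the distance to equilibrium that is not caused by recent activity errors. The first term
  accounts for an input error \<open>\<eta>\<close> acting over ages below \<open>L\<close>, the second one for all older neurons, of
  which few survive.
\<close>

definition remainder :: "real \<Rightarrow> real \<Rightarrow> real" where
  "remainder \<eta> L = r\<^sub>M * C * \<eta> * L\<^sup>2 + (2 * r\<^sub>M / r\<^sub>0 + 1) * exp (- (r\<^sub>0 * L))"

lemma activity_shift_measurable:
  fixes I :: "real \<Rightarrow> real"
  assumes I: "I \<in> borel_measurable (lebesgue_on {-d..})" and e: "- d \<le> e"
  shows "(\<lambda>s. I (s + e)) \<in> borel_measurable (lebesgue_on {0<..})"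
proof -
  have "(\<lambda>s. indicator {-d..} s * I s) \<in> borel_measurable lebesgue"
    using I by (simp add: borel_measurable_restrict_space_iff)
  from borel_measurable_affine[OF this, of 1 e]
  have "(\<lambda>s. indicator {-d..} (e + s) * I (e + s)) \<in> borel_measurable lebesgue"
    by simp
  then have "(\<lambda>s. indicator {0<..} s * (indicator {-d..} (e + s) * I (e + s))) \<in> borel_measurable lebesgue"
    by (intro borel_measurable_times[OF borel_measurable_indicator]) auto
  also have "(\<lambda>s. indicator {0<..} s * (indicator {-d..} (e + s) * I (e + s)))
      = (\<lambda>s. indicator {0<..} s * I (s + e))"
    using e by (auto simp: fun_eq_iff indicator_def add.commute)
  finally show ?thesis
    by (simp add: borel_measurable_restrict_space_iff)
qed

end

text \<open>
  A solution for one fixed delay. All estimates below depend on the parameters of \<open>firing_rate\<close> only, so they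
  are uniform in \<open>d\<close>.
\<close>

locale delayed_flow = firing_rate +
  fixes n\<^sub>i\<^sub>n\<^sub>i :: "real \<Rightarrow> real" and I\<^sub>i\<^sub>n\<^sub>i d :: real
    and n :: "real \<Rightarrow> real \<Rightarrow> real" and I :: "real \<Rightarrow> real"
  assumes d_pos: "0 < d" and n_ini: "prob_density n\<^sub>i\<^sub>n\<^sub>i"
    and sol: "delayed_solution r\<^sub>M r n\<^sub>i\<^sub>n\<^sub>i I\<^sub>i\<^sub>n\<^sub>i d n I"
begin

lemma I_range: "- d \<le> t \<Longrightarrow> I t \<in> {0..r\<^sub>M}"
  using sol by (auto simp: delayed_solution_def)

lemma I_shift_measurable: "- d \<le> e \<Longrightarrow> (\<lambda>s. I (s + e)) \<in> borel_measurable (lebesgue_on {0<..})"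
  using activity_shift_measurable[of I d e] sol by (simp add: delayed_solution_def)

lemma density:
  assumes "0 \<le> t"
  shows "set_integrable lebesgue {0<..} (n t)" "AE x in lebesgue. 0 < x \<longrightarrow> 0 \<le> n t x"
    "(LINT x:{0<..}|lebesgue. n t x) = 1"
  using sol assms by (auto simp: delayed_solution_def prob_density_def)

lemma activity: "0 \<le> t \<Longrightarrow> I t = (LINT x:{0<..}|lebesgue. r x (I (t - d)) * n t x)"
  using sol by (auto simp: delayed_solution_def)

lemma characteristics_born:
  assumes "0 \<le> t"
  shows "AE x in lebesgue. 0 < x \<and> x < t \<longrightarrow>
    n t x = I (t - x) * exp (- (LINT s:{0..x}|lebesgue. r (0 + s) (I (s + (t - x - d)))))"
proof -
  have "AE x in lebesgue. 0 < x \<longrightarrow> n t x =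
          (if t \<le> x
           then n\<^sub>i\<^sub>n\<^sub>i (x - t) * exp (- (LINT s:{0..t}|lebesgue. r (x - t + s) (I (s - d))))
           else I (t - x) * exp (- (LINT s:{0..x}|lebesgue. r s (I (t - x + s - d)))))"
    using sol assms by (auto simp: delayed_solution_def)
  moreover have "(\<lambda>s. r s (I (t - x + s - d))) = (\<lambda>s. r (0 + s) (I (s + (t - x - d))))" for x
    by (simp add: algebra_simps)
  ultimately show ?thesis
    by (auto elim!: eventually_mono)
qed

lemma characteristics_initial:
  assumes "0 \<le> t"
  shows "AE x in lebesgue. 0 < x \<and> t \<le> x \<longrightarrow>
    n t x = n\<^sub>i\<^sub>n\<^sub>i (x - t) * exp (- (LINT s:{0..t}|lebesgue. r (x - t + s) (I (s + (- d)))))"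
proof -
  have "AE x in lebesgue. 0 < x \<longrightarrow> n t x =
          (if t \<le> x
           then n\<^sub>i\<^sub>n\<^sub>i (x - t) * exp (- (LINT s:{0..t}|lebesgue. r (x - t + s) (I (s - d))))
           else I (t - x) * exp (- (LINT s:{0..x}|lebesgue. r s (I (t - x + s - d)))))"
    using sol assms by (auto simp: delayed_solution_def)
  then show ?thesis
    by (auto elim!: eventually_mono)
qed

lemma born_le:
  assumes "0 \<le> t"
  shows "AE x in lebesgue. 0 < x \<and> x < t \<longrightarrow> n t x \<le> r\<^sub>M * exp (- (r\<^sub>0 * x))"
  using characteristics_born[OF assms]
proof eventually_elim
  case (elim x)
  show ?case
  proof
    assume x: "0 < x \<and> x < t"
    have "r\<^sub>0 * (x - 0) \<le> (LINT s:{0..x}|lebesgue. r (0 + s) (I (s + (t - x - d))))"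
      using rate_along_bounds[of 0 "\<lambda>s. I (s + (t - x - d))" 0 x] x d_pos
        I_shift_measurable[of "t - x - d"] I_range by auto
    then show "n t x \<le> r\<^sub>M * exp (- (r\<^sub>0 * x))"
      using elim x I_range[of "t - x"] d_pos rM_pos by (auto intro!: mult_mono)
  qed
qed

lemma initial_le:
  assumes t: "0 \<le> t"
  shows "AE x in lebesgue. 0 < x \<and> t \<le> x \<longrightarrow> n t x \<le> \<bar>n\<^sub>i\<^sub>n\<^sub>i (x - t)\<bar> * exp (- (r\<^sub>0 * t))"
  using characteristics_initial[OF assms]
proof eventually_elim
  case (elim x)
  show ?case
  proof
    assume x: "0 < x \<and> t \<le> x"
    have "r\<^sub>0 * (t - 0) \<le> (LINT s:{0..t}|lebesgue. r (x - t + s) (I (s + (- d))))"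
      using rate_along_bounds[of "x - t" "\<lambda>s. I (s + (- d))" 0 t] x t
        I_shift_measurable[of "- d"] I_range by auto
    then show "n t x \<le> \<bar>n\<^sub>i\<^sub>n\<^sub>i (x - t)\<bar> * exp (- (r\<^sub>0 * t))"
      using elim x by (auto intro!: mult_mono)
  qed
qed

text \<open>
  Neurons younger than \<open>L\<close> were born at time \<open>t - x\<close> within the window: their number differs from the
  stationary one by the activity error at birth times survival, plus the effect of the input error on
  the survival probability. Older neurons, of either population, are bounded by exponential decay in age;
  those from the initial datum have lived through the whole time \<open>t \<ge> L\<close>.
\<close>

lemma near_stationary_majorant:
  assumes J: "J \<in> {0..r\<^sub>M}" and L: "0 < L" "L \<le> t"
    and past: "\<And>\<tau>. t - L \<le> \<tau> \<Longrightarrow> \<tau> \<le> t \<Longrightarrow> \<bar>I (\<tau> - d) - J\<bar> \<le> \<eta>"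
    and recent: "\<And>\<tau>. t - L \<le> \<tau> \<Longrightarrow> \<tau> < t \<Longrightarrow> \<bar>I \<tau> - Phi r J\<bar> \<le> M"
  shows "\<exists>v. set_integrable lebesgue {0<..} v \<and> (LINT x:{0<..}|lebesgue. v x) \<le> remainder \<eta> L \<and>
    (AE x in lebesgue. 0 < x \<longrightarrow> 0 \<le> v x \<and> \<bar>n t x - nbar r x J\<bar> \<le> M * survival J x + v x)"
proof -
  have t: "0 \<le> t" using L by simp
  have \<eta>: "0 \<le> \<eta>" using past[of t] L by simp
  have M: "0 \<le> M" using recent[of "t - L"] L by simp
  \<comment> \<open>Effect of the input error on young neurons, old neurons of both populations, and
    initial neurons.\<close>
  define v1 where "v1 x = indicator {0<..<L} x * (r\<^sub>M * C * \<eta> * L)" for x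
  define v2 where "v2 x = indicator {L..} x * (2 * r\<^sub>M * exp (- (r\<^sub>0 * x)))" for x
  \<comment> \<open>The shape - t + 1 * x fits the substitution rule for affine maps.\<close>
  define v3 where "v3 x = indicator {0<..} (- t + 1 * x) * \<bar>n\<^sub>i\<^sub>n\<^sub>i (- t + 1 * x)\<bar> * exp (- (r\<^sub>0 * t))" for x
  define v where "v x = v1 x + v2 x + v3 x" for x
  have v1: "integrable lebesgue v1" "(LINT x|lebesgue. v1 x) = r\<^sub>M * C * \<eta> * L * L"
    using L by (auto simp: v1_def[abs_def])
  have v2: "integrable lebesgue v2" "(LINT x|lebesgue. v2 x) = 2 * r\<^sub>M / r\<^sub>0 * exp (- (r\<^sub>0 * L))"
  proof -
    have eq: "v2 x = (2 * r\<^sub>M) * (indicator {L..} x *\<^sub>R exp (- (r\<^sub>0 * x)))" for x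
      by (simp add: v2_def)
    have int: "integrable lebesgue (\<lambda>x. indicator {L..} x *\<^sub>R exp (- (r\<^sub>0 * x)))"
      using exp_decay_integrable[OF r0_pos, of L] by (simp only: set_integrable_def)
    then show "integrable lebesgue v2"
      unfolding eq[abs_def] by (rule integrable_mult_right)
    show "(LINT x|lebesgue. v2 x) = 2 * r\<^sub>M / r\<^sub>0 * exp (- (r\<^sub>0 * L))"
      unfolding eq integral_mult_right_zero
      using exp_decay_integral[OF r0_pos, of L] by (simp add: set_lebesgue_integral_def)
  qed
  have v3: "integrable lebesgue v3" "(LINT x|lebesgue. v3 x) = exp (- (r\<^sub>0 * t))"
  proof -
    let ?f = "\<lambda>y. indicator {0<..} y * \<bar>n\<^sub>i\<^sub>n\<^sub>i y\<bar>"
    have int: "integrable lebesgue ?f"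
      using n_ini set_integrable_abs[of lebesgue "{0<..}" n\<^sub>i\<^sub>n\<^sub>i]
      by (simp add: prob_density_def set_integrable_def)
    have "(LINT y|lebesgue. ?f y) = (LINT y|lebesgue. indicator {0<..} y *\<^sub>R n\<^sub>i\<^sub>n\<^sub>i y)"
    proof (rule integral_cong_AE)
      have "AE x in lebesgue. 0 < x \<longrightarrow> 0 \<le> n\<^sub>i\<^sub>n\<^sub>i x"
        using n_ini by (simp add: prob_density_def)
      then show "AE y in lebesgue. ?f y = indicator {0<..} y *\<^sub>R n\<^sub>i\<^sub>n\<^sub>i y"
        by eventually_elim (auto simp: indicator_def)
      show "(\<lambda>y. indicator {0<..} y *\<^sub>R n\<^sub>i\<^sub>n\<^sub>i y) \<in> borel_measurable lebesgue"
        using n_ini by (auto simp: prob_density_def set_integrable_def)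
    qed (use int in auto)
    also have "\<dots> = 1"
      using n_ini by (simp add: prob_density_def set_lebesgue_integral_def)
    finally have "(LINT y|lebesgue. ?f y) = 1" .
    then have "(LINT x|lebesgue. ?f (- t + 1 * x)) = 1"
      using lebesgue_integral_real_affine[of 1 ?f "- t"] by simp
    then show "(LINT x|lebesgue. v3 x) = exp (- (r\<^sub>0 * t))"
      unfolding v3_def integral_mult_left_zero by simp
    show "integrable lebesgue v3"
      unfolding v3_def[abs_def]
      by (intro integrable_mult_left lebesgue_integrable_real_affine[OF int]) auto
  qed
  have restrict: "indicator {0<..} x *\<^sub>R v x = v1 x + v2 x + v3 x" for x
    using L by (auto simp: v_def v1_def v2_def v3_def indicator_def)
  have "set_integrable lebesgue {0<..} v"
    unfolding set_integrable_def restrict using v1 v2 v3 by simp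
  moreover have "(LINT x:{0<..}|lebesgue. v x) \<le> remainder \<eta> L"
  proof -
    have "(LINT x:{0<..}|lebesgue. v x) =
        r\<^sub>M * C * \<eta> * L * L + 2 * r\<^sub>M / r\<^sub>0 * exp (- (r\<^sub>0 * L)) + exp (- (r\<^sub>0 * t))"
      unfolding set_lebesgue_integral_def restrict using v1 v2 v3 by simp
    moreover have "exp (- (r\<^sub>0 * t)) \<le> exp (- (r\<^sub>0 * L))"
      using L r0_pos by simp
    ultimately show ?thesis
      by (simp add: remainder_def power2_eq_square algebra_simps)
  qed
  moreover have "AE x in lebesgue. 0 < x \<longrightarrow> 0 \<le> v x \<and> \<bar>n t x - nbar r x J\<bar> \<le> M * survival J x + v x"
  proof -
    have "AE x in lebesgue. x \<noteq> t"
      by (simp add: AE_completion_iff AE_lborel_singleton)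
    with density(2)[OF t] characteristics_born[OF t] born_le[OF t] initial_le[OF t]
    show ?thesis
    proof eventually_elim
      case (elim x)
      show ?case
      proof
        assume x: "0 < x"
        have nonneg: "0 \<le> v1 x" "0 \<le> v2 x" "0 \<le> v3 x"
          using rM_pos C_nonneg \<eta> L by (auto simp: v1_def v2_def v3_def)
        have MS: "0 \<le> M * survival J x" using M by simp
        have "\<bar>n t x - nbar r x J\<bar> \<le> M * survival J x + v x"
        proof (cases "x < L")
          case True
          let ?E = "exp (- (LINT s:{0..x}|lebesgue. r (0 + s) (I (s + (t - x - d)))))"
          have G: "(\<lambda>s. I (s + (t - x - d))) \<in> borel_measurable (lebesgue_on {0<..})"
            "\<And>s. 0 < s \<Longrightarrow> I (s + (t - x - d)) \<in> {0..r\<^sub>M}"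
            using True L I_shift_measurable[of "t - x - d"] I_range by auto
          have "\<bar>?E - survival J x\<bar> \<le> \<bar>(LINT s:{0..x}|lebesgue. r (0 + s) (I (s + (t - x - d)))) - firing_R r x J\<bar>"
          proof (rule abs_exp_neg_diff_le)
            have "r\<^sub>0 * (x - 0) \<le> (LINT s:{0..x}|lebesgue. r (0 + s) (I (s + (t - x - d))))"
              using rate_along_bounds[OF order_refl G, of 0 x] x by auto
            moreover have "0 \<le> r\<^sub>0 * (x - 0)" using r0_pos x by simp
            ultimately show "0 \<le> (LINT s:{0..x}|lebesgue. r (0 + s) (I (s + (t - x - d))))"
              by linarith
            show "0 \<le> firing_R r x J"
              using firing_R_bounds[OF J] x by simp
          qed
          also have "\<dots> \<le> C * \<eta> * x"
            unfolding firing_R_Icc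
          proof (rule rate_along_diff[OF order_refl G])
            show "\<bar>I (s + (t - x - d)) - J\<bar> \<le> \<eta>" if "0 < s" "s \<le> x" for s
              using past[of "s + (t - x)"] that True by (simp add: algebra_simps)
          qed (use J x in auto)
          also have "\<dots> \<le> C * \<eta> * L"
            using True C_nonneg \<eta> by (intro mult_left_mono) auto
          finally have ES: "\<bar>?E - survival J x\<bar> \<le> C * \<eta> * L" .
          have Itx: "0 \<le> I (t - x)" "I (t - x) \<le> r\<^sub>M"
            using I_range[of "t - x"] True L d_pos by auto
          have split: "n t x - nbar r x J =
              (I (t - x) - Phi r J) * survival J x + I (t - x) * (?E - survival J x)"
            using elim(2) True L x by (simp add: nbar_def algebra_simps)
          have "\<bar>n t x - nbar r x J\<bar>
              \<le> \<bar>I (t - x) - Phi r J\<bar> * survival J x + I (t - x) * \<bar>?E - survival J x\<bar>"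
            unfolding split using Itx by (intro order_trans[OF abs_triangle_ineq]) (simp add: abs_mult)
          moreover have "\<bar>I (t - x) - Phi r J\<bar> * survival J x \<le> M * survival J x"
            using recent[of "t - x"] True x by (intro mult_right_mono) simp_all
          moreover have "I (t - x) * \<bar>?E - survival J x\<bar> \<le> r\<^sub>M * (C * \<eta> * L)"
            using rM_pos by (intro mult_mono[OF Itx(2) ES]) simp_all
          moreover have "v1 x = r\<^sub>M * (C * \<eta> * L)"
            using True x by (simp add: v1_def)
          ultimately have "\<bar>n t x - nbar r x J\<bar> \<le> M * survival J x + v1 x"
            by linarith
          then show ?thesis
            using nonneg by (simp add: v_def)
        next
          case False
          have le: "\<bar>n t x - nbar r x J\<bar> \<le> n t x + r\<^sub>M * exp (- (r\<^sub>0 * x))"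
            using elim(1) x nbar_nonneg[OF J, of x] nbar_le[OF J x] by auto
          also have "\<dots> \<le> v2 x + v3 x"
          proof (cases "x < t")
            case True
            then show ?thesis
              using elim(3) False x by (simp add: v2_def v3_def)
          next
            case tx: False
            have "0 \<le> r\<^sub>M * exp (- (r\<^sub>0 * x))" using rM_pos by simp
            then show ?thesis
              using elim(4,5) tx False x by (simp add: v2_def v3_def)
          qed
          finally show ?thesis
            using nonneg MS by (simp add: v_def)
        qed
        then show "0 \<le> v x \<and> \<bar>n t x - nbar r x J\<bar> \<le> M * survival J x + v x"
          using nonneg by (simp add: v_def)
      qed
    qed
  qed
  ultimately show ?thesis by blast
qed

lemma deviation_integrable:
  assumes "0 \<le> t" "J \<in> {0..r\<^sub>M}"
  shows "set_integrable lebesgue {0<..} (\<lambda>x. n t x - nbar r x J)"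
  using density(1)[OF assms(1)] nbar_integrable[OF assms(2)] by (rule set_integral_diff)

lemma deviation_L1_bounds:
  assumes t: "0 \<le> t" and J: "J \<in> {0..r\<^sub>M}"
  shows "0 \<le> L1_norm (\<lambda>x. n t x - nbar r x J)" "L1_norm (\<lambda>x. n t x - nbar r x J) \<le> 2"
proof -
  note int = density(1)[OF t] nbar_integrable[OF J]
  have "AE x \<in> {0<..} in lebesgue. \<bar>n t x - nbar r x J\<bar> \<le> n t x + nbar r x J"
    using density(2)[OF t] by eventually_elim (use nbar_nonneg[OF J] in \<open>auto simp: abs_le_iff add_nonneg_nonneg\<close>)
  then have "L1_norm (\<lambda>x. n t x - nbar r x J) \<le> (LINT x:{0<..}|lebesgue. n t x + nbar r x J)"
    unfolding L1_norm_def
    by (intro set_integral_mono_AE set_integrable_abs deviation_integrable t J set_integral_add(1) int)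
  also have "\<dots> = 2"
    using int density(3)[OF t] nbar_integral[OF J] by (simp add: set_integral_add)
  finally show "L1_norm (\<lambda>x. n t x - nbar r x J) \<le> 2" .
  show "0 \<le> L1_norm (\<lambda>x. n t x - nbar r x J)"
    unfolding L1_norm_def set_lebesgue_integral_def by (intro integral_nonneg_AE AE_I2) auto
qed

lemma weighted_deviation_le:
  assumes J: "J \<in> {0..r\<^sub>M}" and L: "0 < L" "L \<le> t"
    and past: "\<And>\<tau>. t - L \<le> \<tau> \<Longrightarrow> \<tau> \<le> t \<Longrightarrow> \<bar>I (\<tau> - d) - J\<bar> \<le> \<eta>"
    and recent: "\<And>\<tau>. t - L \<le> \<tau> \<Longrightarrow> \<tau> < t \<Longrightarrow> \<bar>I \<tau> - Phi r J\<bar> \<le> M"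
    and w: "w \<in> borel_measurable (lebesgue_on {0<..})" "\<And>x. 0 < x \<Longrightarrow> 0 \<le> w x"
      "\<And>x. 0 < x \<Longrightarrow> w x \<le> B"
  shows "(LINT x:{0<..}|lebesgue. w x * \<bar>n t x - nbar r x J\<bar>)
    \<le> M * (LINT x:{0<..}|lebesgue. w x * survival J x) + B * remainder \<eta> L"
proof -
  obtain v where v: "set_integrable lebesgue {0<..} v"
      "(LINT x:{0<..}|lebesgue. v x) \<le> remainder \<eta> L"
      "AE x in lebesgue. 0 < x \<longrightarrow> 0 \<le> v x \<and> \<bar>n t x - nbar r x J\<bar> \<le> M * survival J x + v x"
    using near_stationary_majorant[OF J L past recent] by blast
  have B: "0 \<le> B" using w(2,3)[of 1] by simp
  have wS: "set_integrable lebesgue {0<..} (\<lambda>x. w x * survival J x)"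
    using w by (intro survival_weighted_integrable[OF J, of _ B]) auto
  have "(LINT x:{0<..}|lebesgue. w x * \<bar>n t x - nbar r x J\<bar>)
      \<le> (LINT x:{0<..}|lebesgue. M * (w x * survival J x) + B * v x)"
  proof (rule set_integral_mono_AE)
    show "set_integrable lebesgue {0<..} (\<lambda>x. w x * \<bar>n t x - nbar r x J\<bar>)"
      using w L by (intro bounded_mult_integrable[of _ _ _ B] set_integrable_abs deviation_integrable J) auto
    show "set_integrable lebesgue {0<..} (\<lambda>x. M * (w x * survival J x) + B * v x)"
      using wS v by (intro set_integral_add(1)) auto
    show "AE x \<in> {0<..} in lebesgue. w x * \<bar>n t x - nbar r x J\<bar> \<le> M * (w x * survival J x) + B * v x"
      using v(3)
    proof eventually_elim
      case (elim x)
      show ?case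
      proof
        assume "x \<in> {0<..}"
        then have x: "0 < x" by simp
        have "w x * \<bar>n t x - nbar r x J\<bar> \<le> w x * (M * survival J x + v x)"
          using elim x w by (intro mult_left_mono) auto
        also have "\<dots> = M * (w x * survival J x) + w x * v x"
          by (simp add: algebra_simps)
        also have "w x * v x \<le> B * v x"
          using elim x w by (intro mult_right_mono) auto
        finally show "w x * \<bar>n t x - nbar r x J\<bar> \<le> M * (w x * survival J x) + B * v x"
          by simp
      qed
    qed
  qed
  also have "\<dots> = M * (LINT x:{0<..}|lebesgue. w x * survival J x) + B * (LINT x:{0<..}|lebesgue. v x)"
    using wS v(1) by (subst set_integral_add) auto
  also have "\<dots> \<le> M * (LINT x:{0<..}|lebesgue. w x * survival J x) + B * remainder \<eta> L"
    using v(2) B by (intro add_left_mono mult_left_mono)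
  finally show ?thesis .
qed

text \<open>
  Since \<open>u = n(t, \<cdot>) - nbar(\<cdot>, J)\<close> has integral zero, \<open>r\<^sub>0 \<integral> u = 0\<close> can be subtracted. Then the weight
  of \<open>\<bar>u\<bar>\<close> is \<open>r - r\<^sub>0\<close> instead of \<open>r\<close>; against the survival function, \<open>r\<close> itself has total weight
  exactly \<open>1\<close> and would give no contraction.
\<close>

lemma activity_deviation_le:
  assumes t: "0 \<le> t" and J: "J \<in> {0..r\<^sub>M}" and past: "\<bar>I (t - d) - J\<bar> \<le> \<eta>"
  shows "\<bar>I t - Phi r J\<bar> \<le>
    (LINT x:{0<..}|lebesgue. (r x J - r\<^sub>0) * \<bar>n t x - nbar r x J\<bar>) + C * \<eta>"
proof -
  define K where "K = I (t - d)"
  have K: "K \<in> {0..r\<^sub>M}" using I_range[of "t - d"] t by (simp add: K_def)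
  let ?u = "\<lambda>x. n t x - nbar r x J"
  note u = deviation_integrable[OF t J]
  have meas: "(\<lambda>x. r x J - r\<^sub>0) \<in> borel_measurable (lebesgue_on {0<..})"
    by (intro borel_measurable_diff r_meas[OF J]) simp
  have meas2: "(\<lambda>x. r x K - r x J) \<in> borel_measurable (lebesgue_on {0<..})"
    by (intro borel_measurable_diff r_meas J K)
  have b1: "\<bar>r x J - r\<^sub>0\<bar> \<le> r\<^sub>M" if "x \<in> {0<..}" for x
    using r_lower[of x J] r_upper[of x J] J that r0_pos by auto
  have b2: "\<bar>r x K - r x J\<bar> \<le> r\<^sub>M" if "x \<in> {0<..}" for x
    using r_lower[of x J] r_upper[of x J] r_lower[of x K] r_upper[of x K] J K that r0_pos by auto
  have int1: "set_integrable lebesgue {0<..} (\<lambda>x. (r x J - r\<^sub>0) * ?u x)"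
    using bounded_mult_integrable[OF u meas _ b1] by simp
  have int1': "set_integrable lebesgue {0<..} (\<lambda>x. (r x J - r\<^sub>0) * \<bar>?u x\<bar>)"
    using bounded_mult_integrable[OF set_integrable_abs[OF u] meas _ b1] by simp
  have int2: "set_integrable lebesgue {0<..} (\<lambda>x. (r x K - r x J) * n t x)"
    using bounded_mult_integrable[OF density(1)[OF t] meas2 _ b2] by simp
  have intK: "set_integrable lebesgue {0<..} (\<lambda>x. r x K * n t x)"
    using bounded_mult_integrable[OF density(1)[OF t] r_meas[OF K] _, of r\<^sub>M] abs_rate_le K by auto
  have zero: "(LINT x:{0<..}|lebesgue. ?u x) = 0"
    using density(1,3)[OF t] nbar_integrable[OF J] nbar_integral[OF J] by (simp add: set_integral_diff)
  have "I t - Phi r J = (LINT x:{0<..}|lebesgue. r x K * n t x - r x J * nbar r x J)"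
    using activity[OF t] rate_nbar_integral[OF J] intK rate_nbar_integrable[OF J]
    by (simp add: set_integral_diff K_def)
  also have "(\<lambda>x. r x K * n t x - r x J * nbar r x J) =
      (\<lambda>x. ((r x J - r\<^sub>0) * ?u x + (r x K - r x J) * n t x) + r\<^sub>0 * ?u x)"
    by (simp add: fun_eq_iff algebra_simps)
  also have "(LINT x:{0<..}|lebesgue. ((r x J - r\<^sub>0) * ?u x + (r x K - r x J) * n t x) + r\<^sub>0 * ?u x) =
      (LINT x:{0<..}|lebesgue. (r x J - r\<^sub>0) * ?u x) +
      (LINT x:{0<..}|lebesgue. (r x K - r x J) * n t x) + r\<^sub>0 * (LINT x:{0<..}|lebesgue. ?u x)"
    using int1 int2 u by (simp only: set_integral_add set_integrable_mult_right set_integral_mult_right)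
  finally have eq: "I t - Phi r J = (LINT x:{0<..}|lebesgue. (r x J - r\<^sub>0) * ?u x) +
      (LINT x:{0<..}|lebesgue. (r x K - r x J) * n t x)"
    unfolding zero by simp
  have "\<bar>LINT x:{0<..}|lebesgue. (r x J - r\<^sub>0) * ?u x\<bar>
      \<le> (LINT x:{0<..}|lebesgue. (r x J - r\<^sub>0) * \<bar>?u x\<bar>)"
    using r_lower[OF _ J] by (intro abs_set_integral_le int1 int1') (auto simp: abs_mult)
  moreover have "\<bar>LINT x:{0<..}|lebesgue. (r x K - r x J) * n t x\<bar>
      \<le> (LINT x:{0<..}|lebesgue. C * \<eta> * n t x)"
  proof (intro abs_set_integral_le int2)
    show "set_integrable lebesgue {0<..} (\<lambda>x. C * \<eta> * n t x)"
      using density(1)[OF t] by simp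
    show "AE x \<in> {0<..} in lebesgue. \<bar>(r x K - r x J) * n t x\<bar> \<le> C * \<eta> * n t x"
      using r_lipschitz density(2)[OF t]
    proof eventually_elim
      case (elim x)
      show ?case
      proof
        assume "x \<in> {0<..}"
        then have x: "0 < x" by simp
        have "\<bar>r x K - r x J\<bar> \<le> C * \<bar>K - J\<bar>"
          using elim(1) x J K by blast
        also have "\<dots> \<le> C * \<eta>"
          using past C_nonneg by (intro mult_left_mono) (auto simp: K_def)
        finally show "\<bar>(r x K - r x J) * n t x\<bar> \<le> C * \<eta> * n t x"
          using elim(2) x by (auto simp: abs_mult intro: mult_right_mono)
      qed
    qed
  qed
  moreover have "(LINT x:{0<..}|lebesgue. C * \<eta> * n t x) = C * \<eta>"
    using density(3)[OF t] by simp
  ultimately show ?thesis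
    unfolding eq by linarith
qed

text \<open>
  The total weight of recent activity errors is
  \<open>\<integral> (r(x, J) - r\<^sub>0) S dx = 1 - r\<^sub>0 / Phi J \<le> 1 - r\<^sub>0 / r\<^sub>M\<close>.
\<close>

lemma activity_contraction:
  assumes J: "J \<in> {0..r\<^sub>M}" and L: "0 < L" "L \<le> t"
    and past: "\<And>\<tau>. t - L \<le> \<tau> \<Longrightarrow> \<tau> \<le> t \<Longrightarrow> \<bar>I (\<tau> - d) - J\<bar> \<le> \<eta>"
    and recent: "\<And>\<tau>. t - L \<le> \<tau> \<Longrightarrow> \<tau> < t \<Longrightarrow> \<bar>I \<tau> - Phi r J\<bar> \<le> M"
  shows "\<bar>I t - Phi r J\<bar> \<le> (1 - r\<^sub>0 / r\<^sub>M) * M + (r\<^sub>M * remainder \<eta> L + C * \<eta>)"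
proof -
  have M: "0 \<le> M" using recent[of "t - L"] L by simp
  have meas: "(\<lambda>x. r x J - r\<^sub>0) \<in> borel_measurable (lebesgue_on {0<..})"
    by (intro borel_measurable_diff r_meas[OF J]) simp
  have "(LINT x:{0<..}|lebesgue. (r x J - r\<^sub>0) * survival J x) =
      (LINT x:{0<..}|lebesgue. r x J * survival J x) - r\<^sub>0 * (LINT x:{0<..}|lebesgue. survival J x)"
    using rate_survival_integrable[OF J] survival_integrable[OF J]
    by (simp add: left_diff_distrib set_integral_diff)
  also have "\<dots> = 1 - r\<^sub>0 / Phi r J"
    by (simp add: survival_balance[OF J] total_survival_Phi)
  also have "\<dots> \<le> 1 - r\<^sub>0 / r\<^sub>M"
    using Phi_bounds[OF J] r0_pos by (auto intro!: divide_left_mono mult_pos_pos)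
  finally have q: "(LINT x:{0<..}|lebesgue. (r x J - r\<^sub>0) * survival J x) \<le> 1 - r\<^sub>0 / r\<^sub>M" .
  have "\<bar>I t - Phi r J\<bar> \<le>
      (LINT x:{0<..}|lebesgue. (r x J - r\<^sub>0) * \<bar>n t x - nbar r x J\<bar>) + C * \<eta>"
    using L past[of t] by (intro activity_deviation_le J) auto
  also have "(LINT x:{0<..}|lebesgue. (r x J - r\<^sub>0) * \<bar>n t x - nbar r x J\<bar>)
      \<le> M * (LINT x:{0<..}|lebesgue. (r x J - r\<^sub>0) * survival J x) + r\<^sub>M * remainder \<eta> L"
  proof (rule weighted_deviation_le[OF J L past recent meas])
    show "0 < x \<Longrightarrow> 0 \<le> r x J - r\<^sub>0" for x
      using r_lower[OF _ J] by simp
    show "0 < x \<Longrightarrow> r x J - r\<^sub>0 \<le> r\<^sub>M" for x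
      using r_upper[OF _ J, of x] r0_pos by simp
  qed
  also have "M * (LINT x:{0<..}|lebesgue. (r x J - r\<^sub>0) * survival J x) \<le> M * (1 - r\<^sub>0 / r\<^sub>M)"
    using q M by (intro mult_left_mono)
  finally show ?thesis
    by (simp add: mult.commute)
qed

lemma density_deviation_le:
  assumes J: "J \<in> {0..r\<^sub>M}" and L: "0 < L" "L \<le> t"
    and past: "\<And>\<tau>. t - L \<le> \<tau> \<Longrightarrow> \<tau> \<le> t \<Longrightarrow> \<bar>I (\<tau> - d) - J\<bar> \<le> \<eta>"
    and recent: "\<And>\<tau>. t - L \<le> \<tau> \<Longrightarrow> \<tau> < t \<Longrightarrow> \<bar>I \<tau> - Phi r J\<bar> \<le> M"
  shows "L1_norm (\<lambda>x. n t x - nbar r x J) \<le> M / r\<^sub>0 + remainder \<eta> L"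
proof -
  have M: "0 \<le> M" using recent[of "t - L"] L by simp
  have "L1_norm (\<lambda>x. n t x - nbar r x J) \<le>
      M * (LINT x:{0<..}|lebesgue. survival J x) + remainder \<eta> L"
    using weighted_deviation_le[OF J L past recent, of "\<lambda>_. 1" 1] by (simp add: L1_norm_def)
  also have "M * (LINT x:{0<..}|lebesgue. survival J x) \<le> M * (1 / r\<^sub>0)"
    using total_survival_bounds(2)[OF J] M by (intro mult_left_mono)
  finally show ?thesis by simp
qed

text \<open>
  Each window of length \<open>L\<close> contributes one contraction. The trivial bound \<open>r\<^sub>M\<close> starts the iteration, and
  \<open>\<theta> r\<^sub>M / r\<^sub>0\<close> is the sum of the geometric series of the additive errors \<open>\<theta>\<close>.
\<close>

lemma activity_relaxation:
  assumes J: "J \<in> {0..r\<^sub>M}" and L: "0 < L" and t1: "0 \<le> t1"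
    and past: "\<And>\<tau>. t1 \<le> \<tau> \<Longrightarrow> \<tau> < t2 \<Longrightarrow> \<bar>I (\<tau> - d) - J\<bar> \<le> \<eta>"
    and \<theta>: "r\<^sub>M * remainder \<eta> L + C * \<eta> \<le> \<theta>"
  shows "t1 + real m * L \<le> t \<Longrightarrow> t < t2 \<Longrightarrow>
    \<bar>I t - Phi r J\<bar> \<le> (1 - r\<^sub>0 / r\<^sub>M) ^ m * r\<^sub>M + \<theta> * r\<^sub>M / r\<^sub>0"
proof (induction m arbitrary: t)
  case 0
  have range: "I t \<in> {0..r\<^sub>M}" "Phi r J \<in> {0..r\<^sub>M}"
    using I_range[of t] 0 t1 d_pos Phi_bounds(3)[OF J] by auto
  have "0 \<le> \<eta>" using past[of t] 0 by simp
  then have "0 \<le> r\<^sub>M * remainder \<eta> L + C * \<eta>"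
    using rM_pos C_nonneg r0_pos by (simp add: remainder_def)
  then have "0 \<le> \<theta> * r\<^sub>M / r\<^sub>0"
    using \<theta> rM_pos r0_pos by simp
  then show ?case using range by auto
next
  case (Suc m)
  define q where "q = 1 - r\<^sub>0 / r\<^sub>M"
  have q: "0 \<le> q" "q * (\<theta> * r\<^sub>M / r\<^sub>0) + \<theta> = \<theta> * r\<^sub>M / r\<^sub>0"
    using r0_le_rM rM_pos r0_pos by (auto simp: q_def field_simps)
  have t: "t1 + real m * L \<le> t - L"
    using Suc.prems by (simp add: algebra_simps)
  have nonneg: "0 \<le> real m * L" using L by simp
  have "\<bar>I t - Phi r J\<bar> \<le> (1 - r\<^sub>0 / r\<^sub>M) * (q ^ m * r\<^sub>M + \<theta> * r\<^sub>M / r\<^sub>0) + (r\<^sub>M * remainder \<eta> L + C * \<eta>)"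
  proof (rule activity_contraction[OF J L])
    show "L \<le> t" using t nonneg t1 by linarith
    show "\<bar>I (\<tau> - d) - J\<bar> \<le> \<eta>" if "t - L \<le> \<tau>" "\<tau> \<le> t" for \<tau>
      using that t nonneg Suc.prems by (intro past) linarith+
    show "\<bar>I \<tau> - Phi r J\<bar> \<le> q ^ m * r\<^sub>M + \<theta> * r\<^sub>M / r\<^sub>0" if "t - L \<le> \<tau>" "\<tau> < t" for \<tau>
      unfolding q_def using that t Suc.prems by (intro Suc.IH) linarith+
  qed
  also have "\<dots> \<le> q * (q ^ m * r\<^sub>M + \<theta> * r\<^sub>M / r\<^sub>0) + \<theta>"
    unfolding q_def using \<theta> by simp
  also have "\<dots> = q ^ Suc m * r\<^sub>M + (q * (\<theta> * r\<^sub>M / r\<^sub>0) + \<theta>)"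
    by (simp add: algebra_simps)
  also have "q * (\<theta> * r\<^sub>M / r\<^sub>0) + \<theta> = \<theta> * r\<^sub>M / r\<^sub>0"
    by (fact q(2))
  finally show ?case
    unfolding q_def .
qed

end

context firing_rate
begin

text \<open>
  The crucial point is the order of quantifiers: the admissible input error and the length of the transient
  depend on neither the delay, the solution, the target \<open>J\<close>, nor the time interval. First \<open>L\<close> is chosen to
  make the old neurons negligible, then the input error \<open>\<eta>\<close>, then the number \<open>m\<close> of contractions.
\<close>

lemma relaxation:
  assumes \<delta>: "0 < \<delta>"
  obtains \<eta> T where "0 < \<eta>" "0 \<le> T"
    "\<And>n\<^sub>i\<^sub>n\<^sub>i I\<^sub>i\<^sub>n\<^sub>i d n I J t1 t2 t.
      delayed_flow r\<^sub>M r\<^sub>0 C r n\<^sub>i\<^sub>n\<^sub>i I\<^sub>i\<^sub>n\<^sub>i d n I \<Longrightarrow> J \<in> {0..r\<^sub>M} \<Longrightarrow> 0 \<le> t1 \<Longrightarrow>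
      \<forall>\<tau>. t1 \<le> \<tau> \<and> \<tau> < t2 \<longrightarrow> \<bar>I (\<tau> - d) - J\<bar> \<le> \<eta> \<Longrightarrow> t1 + T \<le> t \<Longrightarrow> t < t2 \<Longrightarrow>
      \<bar>I t - Phi r J\<bar> \<le> \<delta> \<and> L1_norm (\<lambda>x. n t x - nbar r x J) \<le> \<delta>"
proof -
  define \<epsilon> where "\<epsilon> = min (\<delta> / 2) (r\<^sub>0 * \<delta> / 4)"
  define \<theta> where "\<theta> = min (\<epsilon> * r\<^sub>0 / r\<^sub>M) (\<delta> * r\<^sub>M / 2)"
  have \<epsilon>: "0 < \<epsilon>" "2 * \<epsilon> \<le> \<delta>" "2 * \<epsilon> / r\<^sub>0 \<le> \<delta> / 2"
    using \<delta> r0_pos by (auto simp: \<epsilon>_def field_simps min_def)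
  have \<theta>: "0 < \<theta>" "\<theta> * r\<^sub>M / r\<^sub>0 \<le> \<epsilon>" "\<theta> / r\<^sub>M \<le> \<delta> / 2"
    using \<delta> \<epsilon>(1) r0_pos rM_pos by (auto simp: \<theta>_def field_simps min_def)
  have "((\<lambda>L. r\<^sub>M * ((2 * r\<^sub>M / r\<^sub>0 + 1) * exp (- (r\<^sub>0 * L)))) \<longlongrightarrow> 0) at_top"
    using r0_pos by real_asymp
  then have "\<forall>\<^sub>F L in at_top. r\<^sub>M * ((2 * r\<^sub>M / r\<^sub>0 + 1) * exp (- (r\<^sub>0 * L))) < \<theta> / 2"
    using \<theta>(1) by (intro order_tendstoD(2)) auto
  then obtain L where L: "0 < L" "r\<^sub>M * ((2 * r\<^sub>M / r\<^sub>0 + 1) * exp (- (r\<^sub>0 * L))) < \<theta> / 2"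
    using eventually_happens'[OF trivial_limit_at_top_linorder
        eventually_conj[OF eventually_gt_at_top[of 0]]] by blast
  define c where "c = r\<^sub>M * (r\<^sub>M * C * L\<^sup>2) + C"
  have c: "0 \<le> c" using rM_pos C_nonneg by (simp add: c_def)
  define \<eta> where "\<eta> = \<theta> / 2 / (c + 1)"
  have \<eta>: "0 < \<eta>" using \<theta> c by (simp add: \<eta>_def)
  have "c * \<eta> \<le> \<theta> / 2"
    using \<theta> c by (simp add: \<eta>_def field_simps)
  moreover have total: "r\<^sub>M * remainder \<eta> L + C * \<eta> =
      c * \<eta> + r\<^sub>M * ((2 * r\<^sub>M / r\<^sub>0 + 1) * exp (- (r\<^sub>0 * L)))"
    by (simp add: remainder_def c_def algebra_simps)
  ultimately have small: "r\<^sub>M * remainder \<eta> L + C * \<eta> \<le> \<theta>"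
    using L(2) unfolding total by linarith
  have q: "0 \<le> 1 - r\<^sub>0 / r\<^sub>M" "1 - r\<^sub>0 / r\<^sub>M < 1"
    using r0_pos rM_pos r0_le_rM by auto
  obtain m where m: "(1 - r\<^sub>0 / r\<^sub>M) ^ m < \<epsilon> / r\<^sub>M"
    using real_arch_pow_inv[OF _ q(2), of "\<epsilon> / r\<^sub>M"] \<epsilon> rM_pos by auto
  show ?thesis
  proof (rule that[of \<eta> "real (Suc m) * L"], goal_cases)
    case 1
    show ?case by (fact \<eta>)
  next
    case 2
    show "0 \<le> real (Suc m) * L" using L by simp
  next
    case (3 n\<^sub>i\<^sub>n\<^sub>i I\<^sub>i\<^sub>n\<^sub>i d n I J t1 t2 t)
    note J = 3(2) and t1 = 3(3) and past = 3(4) and t = 3(5,6)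
    from 3(1) interpret delayed_flow r\<^sub>M r\<^sub>0 C r n\<^sub>i\<^sub>n\<^sub>i I\<^sub>i\<^sub>n\<^sub>i d n I by simp
    have recent: "\<bar>I \<tau> - Phi r J\<bar> \<le> 2 * \<epsilon>" if "t1 + real m * L \<le> \<tau>" "\<tau> < t2" for \<tau>
    proof -
      have "\<bar>I \<tau> - Phi r J\<bar> \<le> (1 - r\<^sub>0 / r\<^sub>M) ^ m * r\<^sub>M + \<theta> * r\<^sub>M / r\<^sub>0"
        using activity_relaxation[OF J L(1) t1 _ small that] past by blast
      moreover have "(1 - r\<^sub>0 / r\<^sub>M) ^ m * r\<^sub>M \<le> \<epsilon>"
        using m rM_pos by (simp add: field_simps)
      ultimately show ?thesis using \<theta>(2) by linarith
    qed
    have split: "real (Suc m) * L = real m * L + L"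
      by (simp add: algebra_simps)
    have nonneg: "0 \<le> real m * L" using L by simp
    have "\<bar>I t - Phi r J\<bar> \<le> \<delta>"
      using recent[of t] t L \<epsilon>(2) unfolding split by linarith
    moreover have "L1_norm (\<lambda>x. n t x - nbar r x J) \<le> 2 * \<epsilon> / r\<^sub>0 + remainder \<eta> L"
    proof (rule density_deviation_le[OF J L(1)])
      show "L \<le> t" using t t1 nonneg unfolding split by linarith
      show "\<bar>I (\<tau> - d) - J\<bar> \<le> \<eta>" if "t - L \<le> \<tau>" "\<tau> \<le> t" for \<tau>
        using that t nonneg unfolding split by (intro past[rule_format]) linarith
      show "\<bar>I \<tau> - Phi r J\<bar> \<le> 2 * \<epsilon>" if "t - L \<le> \<tau>" "\<tau> < t" for \<tau>
        using that t unfolding split by (intro recent) linarith+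
    qed
    moreover have "remainder \<eta> L \<le> \<theta> / r\<^sub>M"
    proof -
      have "0 \<le> C * \<eta>" using C_nonneg \<eta> by simp
      then show ?thesis
        using small rM_pos by (simp add: pos_le_divide_eq mult.commute)
    qed
    ultimately show ?case
      using \<epsilon>(3) \<theta>(3) by linarith
  qed
qed

lemma Phi_iterate_range:
  assumes "J \<in> {0..r\<^sub>M}"
  shows "(Phi r ^^ k) J \<in> {0..r\<^sub>M}"
  by (induction k) (use assms Phi_bounds(3) in auto)

text \<open>
  On the \<open>k\<close>-th delay interval the input is the \<open>k\<close>-th iterate of \<open>Phi\<close>, after a transient whose length
  does not depend on \<open>d\<close>. For \<open>k = 0\<close> the input is the constant history; the activity on one interval is
  the input on the next one. The transient lengths add up.
\<close>

lemma delayed_activity_follows_iterates: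
  assumes J: "J \<in> {0..r\<^sub>M}" and \<delta>: "0 < \<delta>"
  shows "\<exists>T\<ge>0. \<forall>n\<^sub>i\<^sub>n\<^sub>i d n I t. delayed_flow r\<^sub>M r\<^sub>0 C r n\<^sub>i\<^sub>n\<^sub>i J d n I \<longrightarrow>
    real k * d + T \<le> t \<longrightarrow> t < real (Suc k) * d \<longrightarrow> \<bar>I (t - d) - (Phi r ^^ k) J\<bar> \<le> \<delta>"
  using \<delta>
proof (induction k arbitrary: \<delta>)
  case 0
  show ?case
  proof (intro exI[of _ 0] conjI allI impI)
    fix n\<^sub>i\<^sub>n\<^sub>i :: "real \<Rightarrow> real" and d :: real and n :: "real \<Rightarrow> real \<Rightarrow> real" and I :: "real \<Rightarrow> real" and t :: real
    assume "delayed_flow r\<^sub>M r\<^sub>0 C r n\<^sub>i\<^sub>n\<^sub>i J d n I" and t: "real 0 * d + 0 \<le> t" "t < real (Suc 0) * d"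
    then interpret delayed_flow r\<^sub>M r\<^sub>0 C r n\<^sub>i\<^sub>n\<^sub>i J d n I by simp
    have "I (t - d) = J"
      using sol t by (simp add: delayed_solution_def)
    then show "\<bar>I (t - d) - (Phi r ^^ 0) J\<bar> \<le> \<delta>"
      using 0 by simp
  qed simp
next
  case (Suc k)
  obtain \<eta> T' where \<eta>: "0 < \<eta>" and T': "0 \<le> T'"
    and relax: "\<And>n\<^sub>i\<^sub>n\<^sub>i I\<^sub>i\<^sub>n\<^sub>i d n I J t1 t2 t.
      delayed_flow r\<^sub>M r\<^sub>0 C r n\<^sub>i\<^sub>n\<^sub>i I\<^sub>i\<^sub>n\<^sub>i d n I \<Longrightarrow> J \<in> {0..r\<^sub>M} \<Longrightarrow> 0 \<le> t1 \<Longrightarrow>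
      \<forall>\<tau>. t1 \<le> \<tau> \<and> \<tau> < t2 \<longrightarrow> \<bar>I (\<tau> - d) - J\<bar> \<le> \<eta> \<Longrightarrow> t1 + T' \<le> t \<Longrightarrow> t < t2 \<Longrightarrow>
      \<bar>I t - Phi r J\<bar> \<le> \<delta> \<and> L1_norm (\<lambda>x. n t x - nbar r x J) \<le> \<delta>"
    by (rule relaxation[OF Suc.prems]) blast
  from Suc.IH[OF \<eta>] obtain T where T: "0 \<le> T" and
    IH: "\<And>n\<^sub>i\<^sub>n\<^sub>i d n I t. delayed_flow r\<^sub>M r\<^sub>0 C r n\<^sub>i\<^sub>n\<^sub>i J d n I \<Longrightarrow>
      real k * d + T \<le> t \<Longrightarrow> t < real (Suc k) * d \<Longrightarrow> \<bar>I (t - d) - (Phi r ^^ k) J\<bar> \<le> \<eta>"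
    by blast
  show ?case
  proof (intro exI[of _ "T + T'"] conjI allI impI)
    show "0 \<le> T + T'" using T T' by simp
    fix n\<^sub>i\<^sub>n\<^sub>i :: "real \<Rightarrow> real" and d :: real and n :: "real \<Rightarrow> real \<Rightarrow> real" and I :: "real \<Rightarrow> real" and t :: real
    assume flow: "delayed_flow r\<^sub>M r\<^sub>0 C r n\<^sub>i\<^sub>n\<^sub>i J d n I"
      and t: "real (Suc k) * d + (T + T') \<le> t" "t < real (Suc (Suc k)) * d"
    have "0 < d" using flow by (simp add: delayed_flow_def delayed_flow_axioms_def)
    then have "0 \<le> real k * d + T" using T by simp
    then have "\<bar>I (t - d) - Phi r ((Phi r ^^ k) J)\<bar> \<le> \<delta>"
    proof (rule relax[THEN conjunct1, OF flow Phi_iterate_range[OF J]])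
      show "\<forall>\<tau>. real k * d + T \<le> \<tau> \<and> \<tau> < real (Suc k) * d \<longrightarrow> \<bar>I (\<tau> - d) - (Phi r ^^ k) J\<bar> \<le> \<eta>"
        using IH[OF flow] by blast
    qed (use t in \<open>auto simp: algebra_simps\<close>)
    then show "\<bar>I (t - d) - (Phi r ^^ Suc k) J\<bar> \<le> \<delta>" by simp
  qed
qed

lemma density_follows_iterates:
  assumes J: "J \<in> {0..r\<^sub>M}" and \<delta>: "0 < \<delta>"
  shows "\<exists>T\<ge>0. \<forall>n\<^sub>i\<^sub>n\<^sub>i d n I t. delayed_flow r\<^sub>M r\<^sub>0 C r n\<^sub>i\<^sub>n\<^sub>i J d n I \<longrightarrow>
    real k * d + T \<le> t \<longrightarrow> t < real (Suc k) * d \<longrightarrow>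
    L1_norm (\<lambda>x. n t x - nbar r x ((Phi r ^^ k) J)) \<le> \<delta>"
proof -
  obtain \<eta> T' where \<eta>: "0 < \<eta>" and T': "0 \<le> T'"
    and relax: "\<And>n\<^sub>i\<^sub>n\<^sub>i I\<^sub>i\<^sub>n\<^sub>i d n I J t1 t2 t.
      delayed_flow r\<^sub>M r\<^sub>0 C r n\<^sub>i\<^sub>n\<^sub>i I\<^sub>i\<^sub>n\<^sub>i d n I \<Longrightarrow> J \<in> {0..r\<^sub>M} \<Longrightarrow> 0 \<le> t1 \<Longrightarrow>
      \<forall>\<tau>. t1 \<le> \<tau> \<and> \<tau> < t2 \<longrightarrow> \<bar>I (\<tau> - d) - J\<bar> \<le> \<eta> \<Longrightarrow> t1 + T' \<le> t \<Longrightarrow> t < t2 \<Longrightarrow>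
      \<bar>I t - Phi r J\<bar> \<le> \<delta> \<and> L1_norm (\<lambda>x. n t x - nbar r x J) \<le> \<delta>"
    by (rule relaxation[OF \<delta>]) blast
  from delayed_activity_follows_iterates[OF J \<eta>, of k] obtain T where T: "0 \<le> T" and
    close: "\<And>n\<^sub>i\<^sub>n\<^sub>i d n I t. delayed_flow r\<^sub>M r\<^sub>0 C r n\<^sub>i\<^sub>n\<^sub>i J d n I \<Longrightarrow>
      real k * d + T \<le> t \<Longrightarrow> t < real (Suc k) * d \<Longrightarrow> \<bar>I (t - d) - (Phi r ^^ k) J\<bar> \<le> \<eta>"
    by blast
  show ?thesis
  proof (intro exI[of _ "T + T'"] conjI allI impI)
    show "0 \<le> T + T'" using T T' by simp
    fix n\<^sub>i\<^sub>n\<^sub>i :: "real \<Rightarrow> real" and d :: real and n :: "real \<Rightarrow> real \<Rightarrow> real" and I :: "real \<Rightarrow> real" and t :: real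
    assume flow: "delayed_flow r\<^sub>M r\<^sub>0 C r n\<^sub>i\<^sub>n\<^sub>i J d n I"
      and t: "real k * d + (T + T') \<le> t" "t < real (Suc k) * d"
    have "0 < d" using flow by (simp add: delayed_flow_def delayed_flow_axioms_def)
    then have "0 \<le> real k * d + T" using T by simp
    then show "L1_norm (\<lambda>x. n t x - nbar r x ((Phi r ^^ k) J)) \<le> \<delta>"
    proof (rule relax[THEN conjunct2, OF flow Phi_iterate_range[OF J]])
      show "\<forall>\<tau>. real k * d + T \<le> \<tau> \<and> \<tau> < real (Suc k) * d \<longrightarrow> \<bar>I (\<tau> - d) - (Phi r ^^ k) J\<bar> \<le> \<eta>"
        using close[OF flow] by blast
    qed (use t in auto)
  qed
qed

end

section \<open>Averages over many delays\<close>

context firing_rate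
begin

text \<open>
  The distance is at most \<open>\<delta>\<close> outside the transients and at most \<open>2\<close> within them, and the transients that
  start before \<open>A d\<close> have a total length independent of \<open>d\<close>.
\<close>

lemma average_deviation_vanishes:
  assumes J: "J \<in> {0..r\<^sub>M}" and A: "0 < A"
    and flow: "\<And>d. 0 < d \<Longrightarrow> delayed_flow r\<^sub>M r\<^sub>0 C r n\<^sub>i\<^sub>n\<^sub>i J d (n d) (I d)"
  shows "((\<lambda>d. 1 / d * (LINT t:{0..A * d}|lebesgue.
      L1_norm (\<lambda>x. n d t x - nbar r x ((Phi r ^^ nat \<lfloor>t / d\<rfloor>) J)))) \<longlongrightarrow> 0) at_top"
proof (rule tendstoI)
  let ?f = "\<lambda>d t. L1_norm (\<lambda>x. n d t x - nbar r x ((Phi r ^^ nat \<lfloor>t / d\<rfloor>) J))"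
  fix e :: real assume e: "0 < e"
  \<comment> \<open>The settled phases then contribute at most e / 2 to the average.\<close>
  define \<delta> where "\<delta> = e / (2 * A)"
  have \<delta>: "0 < \<delta>" using e A by (simp add: \<delta>_def)
  have "\<forall>k. \<exists>T\<ge>0. \<forall>d>0. \<forall>t. real k * d + T \<le> t \<longrightarrow> t < real (Suc k) * d \<longrightarrow>
      L1_norm (\<lambda>x. n d t x - nbar r x ((Phi r ^^ k) J)) \<le> \<delta>"
  proof
    fix k
    from density_follows_iterates[OF J \<delta>, of k] flow
    show "\<exists>T\<ge>0. \<forall>d>0. \<forall>t. real k * d + T \<le> t \<longrightarrow> t < real (Suc k) * d \<longrightarrow>
        L1_norm (\<lambda>x. n d t x - nbar r x ((Phi r ^^ k) J)) \<le> \<delta>"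
      by blast
  qed
  then obtain T where T: "\<And>k. 0 \<le> T k"
    and settled: "\<And>k d t. 0 < d \<Longrightarrow> real k * d + T k \<le> t \<Longrightarrow> t < real (Suc k) * d \<Longrightarrow>
      L1_norm (\<lambda>x. n d t x - nbar r x ((Phi r ^^ k) J)) \<le> \<delta>"
    by metis
  define K where "K = nat \<lfloor>A\<rfloor>"
  define B where "B = 2 * (\<Sum>k\<le>K. T k)"
  have bound: "\<bar>1 / d * (LINT t:{0..A * d}|lebesgue. ?f d t)\<bar> \<le> \<delta> * A + B / d" if d: "0 < d" for d
  proof -
    interpret delayed_flow r\<^sub>M r\<^sub>0 C r n\<^sub>i\<^sub>n\<^sub>i J d "n d" "I d" by (rule flow[OF d])
    let ?h = "\<lambda>k t. 2 * indicator {real k * d..real k * d + T k} t :: real"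
    let ?g = "\<lambda>t. \<delta> + (\<Sum>k\<le>K. ?h k t)"
    have h_int: "integrable lebesgue (?h k)" "(LINT t|lebesgue. ?h k t) = 2 * T k" for k
      using T[of k] by auto
    have h_set: "set_integrable lebesgue {0..A * d} (?h k)" for k
      using set_integrable_subset[of lebesgue UNIV "?h k" "{0..A * d}"] h_int
      by (simp add: set_integrable_def)
    have h_le: "(LINT t:{0..A * d}|lebesgue. ?h k t) \<le> 2 * T k" for k
    proof -
      have "(LINT t:{0..A * d}|lebesgue. ?h k t) \<le> (LINT t|lebesgue. ?h k t)"
        unfolding set_lebesgue_integral_def
        using h_set[of k] h_int(1)[of k]
        by (intro integral_mono) (auto simp: set_integrable_def indicator_def)
      then show ?thesis by (simp only: h_int)
    qed
    have sum_set: "set_integrable lebesgue {0..A * d} (\<lambda>t. \<Sum>k\<le>K. ?h k t)"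
      using h_set unfolding set_integrable_def scaleR_sum_right
      by (intro Bochner_Integration.integrable_sum)
    have g_set: "set_integrable lebesgue {0..A * d} ?g"
      by (intro set_integral_add(1) set_integrable_const_Icc sum_set)
    have f_nonneg: "0 \<le> ?f d t" if "t \<in> {0..A * d}" for t
      using that by (intro deviation_L1_bounds(1) Phi_iterate_range J) auto
    have f_le: "?f d t \<le> ?g t" if t: "t \<in> {0..A * d}" for t
    proof -
      define k where "k = nat \<lfloor>t / d\<rfloor>"
      have td: "0 \<le> t / d" "t / d \<le> A"
        using t d by (auto simp: field_simps)
      then have k: "real k \<le> t / d" "t / d < real (Suc k)" "k \<le> K"
        unfolding k_def K_def by (auto intro!: nat_mono floor_mono) linarith+
      then have kt: "real k * d \<le> t" "t < real (Suc k) * d"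
        using d by (auto simp: field_simps)
      have sum: "0 \<le> (\<Sum>k\<in>S. ?h k t)" for S
        by (intro sum_nonneg) auto
      show ?thesis
      \<comment> \<open>If T k exceeds d, the whole k-th delay interval counts as transient.\<close>
      proof (cases "real k * d + T k \<le> t")
        case True
        then show ?thesis
          using settled[OF d True kt(2)] sum[of "{..K}"] by (simp add: k_def)
      next
        case False
        have "?f d t \<le> 2"
          using t by (intro deviation_L1_bounds(2) Phi_iterate_range J) auto
        also have "2 = ?h k t" using False kt by simp
        also have "?h k t \<le> (\<Sum>k\<le>K. ?h k t)"
          using k(3) by (intro member_le_sum) auto
        finally show ?thesis using \<delta> by simp
      qed
    qed
    note le = set_integral_le_nonneg[OF f_nonneg f_le g_set]
    have "(LINT t:{0..A * d}|lebesgue. ?g t) =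
        (LINT t:{0..A * d}|lebesgue. \<delta>) + (LINT t:{0..A * d}|lebesgue. \<Sum>k\<le>K. ?h k t)"
      by (intro set_integral_add(2) set_integrable_const_Icc sum_set)
    also have "(LINT t:{0..A * d}|lebesgue. \<Sum>k\<le>K. ?h k t) = (\<Sum>k\<le>K. LINT t:{0..A * d}|lebesgue. ?h k t)"
      using h_set unfolding set_lebesgue_integral_def set_integrable_def scaleR_sum_right
      by (intro Bochner_Integration.integral_sum) auto
    also have "\<dots> \<le> (\<Sum>k\<le>K. 2 * T k)"
      by (intro sum_mono h_le)
    also have "(LINT t:{0..A * d}|lebesgue. \<delta>) = \<delta> * (A * d)"
      using A d by (simp add: set_integral_const_Icc)
    finally have "(LINT t:{0..A * d}|lebesgue. ?f d t) \<le> \<delta> * (A * d) + B"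
      using le(2) by (simp add: B_def sum_distrib_left)
    then have "(LINT t:{0..A * d}|lebesgue. ?f d t) / d \<le> (\<delta> * (A * d) + B) / d"
      using d by (intro divide_right_mono) auto
    also have "\<dots> = \<delta> * A + B / d"
      using d by (simp add: field_simps)
    finally show ?thesis
      using le(1) d by simp
  qed
  have "((\<lambda>d. \<delta> * A + B / d) \<longlongrightarrow> \<delta> * A + 0) at_top"
    by (intro tendsto_intros tendsto_divide_0[OF tendsto_const] filterlim_at_top_imp_at_infinity filterlim_ident)
  moreover have "\<delta> * A + 0 < e"
    using e A by (simp add: \<delta>_def)
  ultimately have "\<forall>\<^sub>F d in at_top. \<delta> * A + B / d < e"
    by (rule order_tendstoD(2))
  then show "\<forall>\<^sub>F d in at_top. dist (1 / d * (LINT t:{0..A * d}|lebesgue. ?f d t)) 0 < e"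
    using eventually_gt_at_top[of 0]
    by eventually_elim (use bound in \<open>auto simp: dist_real_def intro: le_less_trans\<close>)
qed

lemma Phi_iterate_two_cycle:
  assumes "Phi r (Phi r J) = J"
  shows "(Phi r ^^ k) J = (if even k then J else Phi r J)"
  by (induction k) (use assms in auto)

end

lemma rmod_double_less_iff:
  fixes t d :: real
  assumes "0 < d" "0 \<le> t"
  shows "t rmod (2 * d) < d \<longleftrightarrow> even (nat \<lfloor>t / d\<rfloor>)"
proof -
  define s where "s = t rmod (2 * d)"
  define m where "m = \<lfloor>t / (2 * d)\<rfloor>"
  have s: "0 \<le> s" "s < 2 * d"
    using assms rmod_nonneg[of "2 * d" t] rmod_less[of "2 * d" t] by (auto simp: s_def)
  have t: "t = s + 2 * d * of_int m"
    using assms by (simp add: s_def m_def rmod_def)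
  have m: "0 \<le> m"
    using assms by (simp add: m_def)
  have "\<lfloor>t / d\<rfloor> = (if s < d then 2 * m else 2 * m + 1)"
    using s assms(1) unfolding t by (intro floor_unique) (auto simp: field_simps)
  then show ?thesis
    using m by (simp add: s_def[symmetric] even_nat_iff)
qed

theorem theorem1p2:
  fixes r\<^sub>M r\<^sub>0 Ibar \<Phi>' :: real
    and r dr :: "real \<Rightarrow> real \<Rightarrow> real"
    and n\<^sub>i\<^sub>n\<^sub>i :: "real \<Rightarrow> real"
  assumes rM_pos: "0 < r\<^sub>M"
    and r_meas: "\<And>J. J \<in> {0..r\<^sub>M} \<Longrightarrow> (\<lambda>x. r x J) \<in> borel_measurable (lebesgue_on {0<..})"
    and r_bounds: "\<And>x J. 0 < x \<Longrightarrow> J \<in> {0..r\<^sub>M} \<Longrightarrow> 0 \<le> r x J \<and> r x J \<le> r\<^sub>M"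
    and dr: "has_partial_I r\<^sub>M r dr"
    and dr_bounded: "\<exists>C. AE (x, J) in lebesgue_on ({0<..} \<times> {0<..<r\<^sub>M}). \<bar>dr x J\<bar> \<le> C"
    and dr_nonpos: "AE (x, J) in lebesgue_on ({0<..} \<times> {0<..<r\<^sub>M}). dr x J \<le> 0"
    and r0_pos: "0 < r\<^sub>0"
    and r_lower: "\<And>x J. 0 < x \<Longrightarrow> J \<in> {0..r\<^sub>M} \<Longrightarrow> r\<^sub>0 \<le> r x J"
    and n_ini: "prob_density n\<^sub>i\<^sub>n\<^sub>i"
    and Ibar: "Ibar \<in> {0..r\<^sub>M}" "Phi r Ibar = Ibar"
    and Phi_deriv: "(Phi r has_real_derivative \<Phi>') (at Ibar within {0..r\<^sub>M})"
    and Phi_deriv_less: "\<Phi>' < -1"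
  shows "\<exists>I\<^sub>m I\<^sub>p. I\<^sub>m \<in> {0..r\<^sub>M} \<and> I\<^sub>p \<in> {0..r\<^sub>M} \<and> I\<^sub>m < Ibar \<and> Ibar < I\<^sub>p \<and>
           Phi r I\<^sub>m = I\<^sub>p \<and> Phi r I\<^sub>p = I\<^sub>m \<and>
           (\<forall>I\<^sub>i\<^sub>n\<^sub>i\<in>{I\<^sub>m, I\<^sub>p}. \<forall>(n :: real \<Rightarrow> real \<Rightarrow> real \<Rightarrow> real) (I :: real \<Rightarrow> real \<Rightarrow> real).
              (\<forall>d>0. delayed_solution r\<^sub>M r n\<^sub>i\<^sub>n\<^sub>i I\<^sub>i\<^sub>n\<^sub>i d (n d) (I d)) \<longrightarrow>
              (\<forall>A>0. ((\<lambda>d. 1 / d *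
                  (LINT t:{0..A * d}|lebesgue. L1_norm (\<lambda>x. n d t x - nbar_per r I\<^sub>i\<^sub>n\<^sub>i d t x)))
                \<longlongrightarrow> 0) at_top))"
proof -
  obtain C where C: "AE (x, J) in lebesgue_on ({0<..} \<times> {0<..<r\<^sub>M}). \<bar>dr x J\<bar> \<le> C"
    using dr_bounded by blast
  note increments = partial_derivative_bounds_increments[OF dr C dr_nonpos]
  interpret firing_rate r\<^sub>M r\<^sub>0 "\<bar>C\<bar>" r
  proof
    show "AE x in lebesgue. 0 < x \<longrightarrow>
        (\<forall>a\<in>{0..r\<^sub>M}. \<forall>b\<in>{0..r\<^sub>M}. a \<le> b \<longrightarrow> r x b \<le> r x a)"
      using increments by eventually_elim auto
    show "AE x in lebesgue. 0 < x \<longrightarrow>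
        (\<forall>a\<in>{0..r\<^sub>M}. \<forall>b\<in>{0..r\<^sub>M}. \<bar>r x a - r x b\<bar> \<le> \<bar>C\<bar> * \<bar>a - b\<bar>)"
      using increments
    proof eventually_elim
      case (elim x)
      show ?case
      proof (intro impI ballI)
        fix a b assume x: "0 < x" and ab: "a \<in> {0..r\<^sub>M}" "b \<in> {0..r\<^sub>M}"
        have *: "\<bar>r x u - r x v\<bar> \<le> \<bar>C\<bar> * (v - u)" if "0 \<le> u" "u \<le> v" "v \<le> r\<^sub>M" for u v
        proof -
          have "C * (v - u) \<le> \<bar>C\<bar> * (v - u)"
            using that by (intro mult_right_mono) auto
          moreover have "r x v \<le> r x u" "r x u - r x v \<le> C * (v - u)"
            using elim x that by auto
          ultimately show ?thesis by linarith
        qed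
        show "\<bar>r x a - r x b\<bar> \<le> \<bar>C\<bar> * \<bar>a - b\<bar>"
          using *[of a b] *[of b a] ab by (cases "a \<le> b") (auto simp: abs_minus_commute)
      qed
    qed
  qed (use rM_pos r0_pos r_meas r_bounds r_lower in auto)
  have "0 < Ibar"
    using Phi_bounds(1)[OF Ibar(1)] Ibar(2) r0_pos by simp
  with antitone_two_cycle[OF Phi_continuous Phi_bounds(3) Phi_antitone _ _ Ibar(2) Phi_deriv Phi_deriv_less]
  obtain I\<^sub>m I\<^sub>p where cycle: "I\<^sub>m \<in> {0..r\<^sub>M}" "I\<^sub>p \<in> {0..r\<^sub>M}" "I\<^sub>m < Ibar" "Ibar < I\<^sub>p"
      "Phi r I\<^sub>m = I\<^sub>p" "Phi r I\<^sub>p = I\<^sub>m"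
    using Ibar(1) by auto
  have "((\<lambda>d. 1 / d * (LINT t:{0..A * d}|lebesgue. L1_norm (\<lambda>x. n d t x - nbar_per r J d t x))) \<longlongrightarrow> 0) at_top"
    if J: "J \<in> {I\<^sub>m, I\<^sub>p}" and A: "0 < A"
      and sol: "\<forall>d>0. delayed_solution r\<^sub>M r n\<^sub>i\<^sub>n\<^sub>i J d (n d) (I d)"
    for J A :: real and n :: "real \<Rightarrow> real \<Rightarrow> real \<Rightarrow> real" and I :: "real \<Rightarrow> real \<Rightarrow> real"
  proof -
    have J_range: "J \<in> {0..r\<^sub>M}" and J_cycle: "Phi r (Phi r J) = J"
      using J cycle by auto
    have "delayed_flow r\<^sub>M r\<^sub>0 \<bar>C\<bar> r n\<^sub>i\<^sub>n\<^sub>i J d (n d) (I d)" if "0 < d" for d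
      by unfold_locales (use that sol n_ini in auto)
    from average_deviation_vanishes[OF J_range A this]
    show ?thesis
    proof (rule Lim_transform_eventually)
      show "\<forall>\<^sub>F d in at_top. 1 / d * (LINT t:{0..A * d}|lebesgue.
            L1_norm (\<lambda>x. n d t x - nbar r x ((Phi r ^^ nat \<lfloor>t / d\<rfloor>) J))) =
          1 / d * (LINT t:{0..A * d}|lebesgue. L1_norm (\<lambda>x. n d t x - nbar_per r J d t x))"
        using eventually_gt_at_top[of 0]
      proof eventually_elim
        case (elim d)
        have "nbar r x ((Phi r ^^ nat \<lfloor>t / d\<rfloor>) J) = nbar_per r J d t x" if "0 \<le> t" for t x
          using rmod_double_less_iff[OF elim that] Phi_iterate_two_cycle[OF J_cycle]
          by (simp add: nbar_per_def)
        then show ?case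
          by (intro arg_cong2[where f = "(*)"] refl set_lebesgue_integral_cong) auto
      qed
    qed
  qed
  with cycle show ?thesis by blast
qed

end
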